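(* Let $d\ge 3$, let $2\le k\le d-1$, put $t_k=\binom{k+1}{2}$, and let $E\subset\mathbb R^d$ be a compact Salem set. If $\dim_{\mathrm H}(E)>k$, then there exist a Borel probability measure $\mu$ supported on $E$ and a Borel set $E_\mu\subset\operatorname{supp}\mu$ with $\mu(E_\mu)=1$ such that, for every $x\in E_\mu$, \[ (\Phi_{k,x})_\#\mu^{k}\ll\mathcal L^{t_k}. \] Consequently, \[ \mathcal L^{t_k}\bigl(\Delta^{\mathrm{nd}}_{k,x}(E)\bigr)>0\qquad(x\in E_\mu). \]
   Context: $\mathcal L^{M}$ is Lebesgue measure on $\mathbb R^M$, $\mu^{k}$ is the $k$-fold product measure, $f_\#$ denotes pushforward, $\dim_{\mathrm H}$ is Hausdorff dimension, and $\widehat\mu(\xi)=\int e^{-2\pi i x\cdot\xi}\,d\mu(x)$. The Fourier dimension of a compact set $E\subset\mathbb R^d$ is the supremum of the $\beta\in[0,d]$ for which $E$ supports a probability measure $\mu$ with $|\widehat\mu(\xi)|\lesssim(1+|\xi|)^{-\beta/2}$. $E$ is a Salem set if its Fourier dimension equals its Hausdorff dimension; equivalently, for every $0<\sigma<\dim_{\mathrm H}(E)$, $E$ supports a probability measure $\mu$ with $|\widehat\mu(\xi)|\lesssim_\sigma(1+|\xi|)^{-\sigma/2}$. For $x\in\mathbb R^d$, put $z_0=x$ and define $\Phi_{k,x}(z_1,\dots,z_k)=(|z_a-z_b|^2)_{0\le a<b\le k}\in\mathbb R^{t_k}$. The set $\Delta^{\mathrm{nd}}_{k,x}(E)\subset\mathbb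 R^{t_k}$ is the set of distance tuples $(|z_a-z_b|)_{0\le a<b\le k}$ with $z_0=x$, $z_1,\dots,z_k\in E$ and $z_0,\dots,z_k$ affinely independent. *)

theory Defs
  imports "HOL-Analysis.Analysis" "HOL-Probability.Probability"
begin

text \<open>
  Used for \<open>s > 0\<close> only, where empty members of a cover contribute \<open>0 powr s = 0\<close>
  (for \<open>s = 0\<close> singletons would count \<open>0 powr 0 = 0\<close>, so this is not counting measure).
  Boundedness is required because \<open>diameter\<close> is not meaningful on unbounded sets.
\<close>

definition hausdorff_premeasure :: "real \<Rightarrow> real \<Rightarrow> 'a::metric_space set \<Rightarrow> ennreal" where
  "hausdorff_premeasure s \<delta> A =
     (INF U \<in> {U :: nat \<Rightarrow> 'a set. A \<subseteq> (\<Union>i. U i) \<and> (\<forall>i. bounded (U i) \<and> diameter (U i) \<le> \<delta>)}.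
        \<Sum>i. ennreal (diameter (U i) powr s))"

definition hausdorff_measure :: "real \<Rightarrow> 'a::metric_space set \<Rightarrow> ennreal" where
  "hausdorff_measure s A = (SUP \<delta> \<in> {0<..}. hausdorff_premeasure s \<delta> A)"

text \<open>
  In a Euclidean space the set of exponents below contains every \<open>s > DIM('a)\<close>,
  so the real infimum is the usual one.
\<close>

definition hausdorff_dim :: "'a::euclidean_space set \<Rightarrow> real" where
  "hausdorff_dim A = Inf {s. 0 < s \<and> hausdorff_measure s A = 0}"

definition msupport :: "'a::topological_space measure \<Rightarrow> 'a set" where
  "msupport \<mu> = {x. \<forall>U. open U \<longrightarrow> x \<in> U \<longrightarrow> emeasure \<mu> U > 0}"

definition borel_prob_on :: "'a::topological_space set \<Rightarrow> 'a measure \<Rightarrow> bool" where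
  "borel_prob_on E \<mu> \<longleftrightarrow> sets \<mu> = sets borel \<and> prob_space \<mu> \<and> msupport \<mu> \<subseteq> E"

definition fourier_measure :: "'a::euclidean_space measure \<Rightarrow> 'a \<Rightarrow> complex" where
  "fourier_measure \<mu> \<xi> =
     (LINT x|\<mu>. exp (- 2 * complex_of_real pi * \<i> * complex_of_real (x \<bullet> \<xi>)))"

text \<open>
  For nonempty compact \<open>E\<close> the exponent \<open>\<beta> = 0\<close> is always admissible, so the supremum
  is over a nonempty bounded set; for \<open>E = {}\<close> the value is unspecified.
\<close>

definition fourier_dim :: "'a::euclidean_space set \<Rightarrow> real" where
  "fourier_dim E = Sup {\<beta>. 0 \<le> \<beta> \<and> \<beta> \<le> real DIM('a) \<and>
     (\<exists>\<mu>. borel_prob_on E \<mu> \<and>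
        (\<exists>C. \<forall>\<xi>. cmod (fourier_measure \<mu> \<xi>) \<le> C * (1 + norm \<xi>) powr (- \<beta> / 2)))}"

definition salem_set :: "'a::euclidean_space set \<Rightarrow> bool" where
  "salem_set E \<longleftrightarrow> fourier_dim E = hausdorff_dim E"

text \<open>
  The space \<open>\<real>\<^bsup>t\<^esup>\<close> with \<open>t = (k + 1) choose 2\<close> has its coordinates indexed by the pairs
  \<open>a < b \<le> k\<close>; its points are the functions extensional on \<open>dist_pairs k\<close>, and
  \<open>lebesgue_tuples k\<close> is the \<open>t\<close>-fold product of one-dimensional Lebesgue measure on Borel sets.
\<close>

definition dist_pairs :: "nat \<Rightarrow> (nat \<times> nat) set" where
  "dist_pairs k = {(a, b). a < b \<and> b \<le> k}"

definition lebesgue_tuples :: "nat \<Rightarrow> (nat \<times> nat \<Rightarrow> real) measure" where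
  "lebesgue_tuples k = PiM (dist_pairs k) (\<lambda>_. lborel)"

text \<open>The update \<open>z(0 := x)\<close> realises \<open>z\<^sub>0 = x\<close>.\<close>

definition Phi :: "nat \<Rightarrow> 'a::real_normed_vector \<Rightarrow> (nat \<Rightarrow> 'a) \<Rightarrow> (nat \<times> nat \<Rightarrow> real)" where
  "Phi k x z = (\<lambda>(a, b)\<in>dist_pairs k. (norm ((z(0 := x)) a - (z(0 := x)) b))\<^sup>2)"

definition measure_power :: "nat \<Rightarrow> 'a measure \<Rightarrow> (nat \<Rightarrow> 'a) measure" where
  "measure_power k \<mu> = PiM {1..k} (\<lambda>_. \<mu>)"

text \<open>
  \<open>affine_dependent\<close> is a predicate on sets, so independence of the family
  \<open>z 0, \<dots>, z k\<close> also needs the points to be distinct.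
\<close>

definition nondeg_dist_set :: "nat \<Rightarrow> 'a::real_normed_vector \<Rightarrow> 'a set \<Rightarrow> (nat \<times> nat \<Rightarrow> real) set" where
  "nondeg_dist_set k x E =
     {(\<lambda>(a, b)\<in>dist_pairs k. norm (z a - z b)) | z.
        z 0 = x \<and> (\<forall>i\<in>{1..k}. z i \<in> E) \<and>
        inj_on z {0..k} \<and> \<not> affine_dependent (z ` {0..k})}"

lemma finite_dist_pairs: "finite (dist_pairs k)"
  by (rule finite_subset[of _ "{..k} \<times> {..k}"]) (auto simp: dist_pairs_def)

lemma card_dist_pairs: "card (dist_pairs k) = (k + 1) choose 2"
proof (induction k)
  case 0
  have "dist_pairs 0 = {}" by (auto simp: dist_pairs_def)
  then show ?case by simp
next
  case (Suc k)
  have "dist_pairs (Suc k) = dist_pairs k \<union> (\<lambda>a. (a, Suc k)) ` {..k}"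
    by (auto simp: dist_pairs_def)
  moreover have "dist_pairs k \<inter> (\<lambda>a. (a, Suc k)) ` {..k} = {}"
    by (auto simp: dist_pairs_def)
  moreover have "card ((\<lambda>a. (a, Suc k)) ` {..k}) = Suc k"
    by (subst card_image) (auto simp: inj_on_def)
  ultimately have "card (dist_pairs (Suc k)) = card (dist_pairs k) + Suc k"
    by (simp add: card_Un_disjoint finite_dist_pairs)
  with Suc show ?case by (simp add: numeral_2_eq_2)
qed

text \<open>The pushforward below is genuine: \<open>distr\<close> along a non-measurable map would be junk.\<close>

lemma measurable_Phi:
  fixes \<mu> :: "'a::euclidean_space measure"
  assumes "sets \<mu> = sets borel"
  shows "Phi k x \<in> measurable (measure_power k \<mu>) (lebesgue_tuples k)"
proof -
  have c: "(\<lambda>z. (z(0 := x)) i) \<in> borel_measurable (measure_power k \<mu>)" if "i \<le> k" for i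
  proof (cases "i = 0")
    case False
    with that have "i \<in> {1..k}" by auto
    then have "(\<lambda>z. z i) \<in> measurable (measure_power k \<mu>) \<mu>"
      unfolding measure_power_def by (rule measurable_component_singleton)
    then have "(\<lambda>z. z i) \<in> borel_measurable (measure_power k \<mu>)"
      using assms by (metis measurable_cong_sets)
    then show ?thesis using False by simp
  qed simp
  show ?thesis
    unfolding Phi_def lebesgue_tuples_def
  proof (rule measurable_restrict)
    fix p assume "p \<in> dist_pairs k"
    then obtain a b where p: "p = (a, b)" "a \<le> k" "b \<le> k"
      by (auto simp: dist_pairs_def)
    show "(\<lambda>z. case p of (a, b) \<Rightarrow> (norm ((z(0 := x)) a - (z(0 := x)) b))\<^sup>2)
          \<in> measurable (measure_power k \<mu>) lborel"
      unfolding p prod.case measurable_lborel1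
      using borel_measurable_power[OF measurable_compose[OF borel_measurable_diff[OF c c] borel_measurable_norm]] p(2,3)
      by simp
  qed
qed

end

theory Submission
  imports Defs
begin

text \<open>
  Fix a measure \<open>\<mu>\<close> on \<open>E\<close> whose Fourier transform decays like \<open>|\<xi>|\<^sup>-\<^sup>s\<close> with \<open>k < 2s < d\<close>. Since \<open>s > 1\<close>, the
  projections of \<open>\<mu>\<close> to lines have uniformly bounded densities, so slabs of width \<open>r\<close> have measure
  \<open>O(r)\<close>; since \<open>2s > k\<close>, the energies \<open>\<integral>\<integral> |y - y'|\<^sup>-\<^sup>j d\<mu> d\<mu>\<close> with \<open>j \<le> k\<close> are finite.

  The points \<open>z\<close> satisfying \<open>||z - y|\<^sup>2 - |z - y'|\<^sup>2| < r\<close> form a slab orthogonal to \<open>y - y'\<close> of width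
  \<open>r / |y - y'|\<close>. Hence the average over base points \<open>z\<^sub>0, \<dots>, z\<^sub>j\<^sub>-\<^sub>1\<close> of the \<open>\<mu> \<times> \<mu>\<close> measure of the pairs
  \<open>(y, y')\<close> whose distances to all base points agree up to \<open>r\<close> is at most \<open>r\<^sup>j\<close> times the energy. By Fatou,
  for almost every base tuple the image of \<open>\<mu>\<close> under \<open>y \<mapsto> (|z\<^sub>a - y|\<^sup>2)\<^sub>a\<close> has square-integrable density.
  Fubini's theorem adds the points one at a time.
\<close>

subsection \<open>Slabs and energies of measures with Fourier decay\<close>

text \<open>For a fixed base tuple the distance map may degenerate: no lower bound on a determinant
  of base points is at hand. Averaging over the base avoids determinants. For a fixed pair y, y' the
  base points are independent with law \<mu> and each must fall into the same slab, so the
  probabilities multiply. The base points are thus drawn from the very measure whose image is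
  studied, which is why the conclusion is obtained for almost every x.

  The hypothesis k \<ge> 2 enters because k < 2s then forces s > 1, the threshold for integrability
  of (1 + |t|)^(-s) on the line. The strict bound 2s < d makes |t|^(-2s/d) integrable at 0. Adding a
  point to j base points costs the energy of order j, so the last point, added to k base points, is
  the critical one.

  The second conclusion concerns distances and not their squares. Instead of moving null sets
  through square roots, the argument is run for a general function of the distance.\<close>

lemma nn_integral_abs_le:
  fixes f :: "real \<Rightarrow> ennreal"
  assumes [measurable]: "f \<in> borel_measurable borel"
  shows "(\<integral>\<^sup>+x. f \<bar>x\<bar> \<partial>lborel) \<le> 2 * (\<integral>\<^sup>+x. f x * indicator {0..} x \<partial>lborel)"
proof -
  have "(\<integral>\<^sup>+x. f \<bar>x\<bar> \<partial>lborel)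
      \<le> (\<integral>\<^sup>+x. f x * indicator {0..} x + f (-x) * indicator {0..} (-x) \<partial>lborel)"
    by (intro nn_integral_mono) (auto simp: indicator_def)
  also have "\<dots> = (\<integral>\<^sup>+x. f x * indicator {0..} x \<partial>lborel) + (\<integral>\<^sup>+x. f (-x) * indicator {0..} (-x) \<partial>lborel)"
    by (intro nn_integral_add) auto
  also have "(\<integral>\<^sup>+x. f (-x) * indicator {0..} (-x) \<partial>lborel) = (\<integral>\<^sup>+x. f x * indicator {0..} x \<partial>lborel)"
    using nn_integral_real_affine[of "\<lambda>x. f x * indicator {0..} x" "-1" 0] by simp
  finally show ?thesis by (simp add: mult_2)
qed

lemma nn_integral_decay_finite:
  fixes s :: real assumes "s > 1"
  shows "(\<integral>\<^sup>+t. ennreal ((1 + \<bar>t\<bar>) powr (-s)) \<partial>lborel) < \<infinity>"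
proof -
  have a: "(\<integral>\<^sup>+t. ennreal (t powr (-s)) * indicator {1..} t \<partial>lborel) < \<infinity>"
    using nn_integral_has_integral_lebesgue'[OF _ has_integral_powr_to_inf[of "-s" 1]] assms by simp
  have "(\<integral>\<^sup>+t. ennreal ((1 + \<bar>t\<bar>) powr (-s)) \<partial>lborel)
      \<le> 2 * (\<integral>\<^sup>+t. ennreal ((1 + t) powr (-s)) * indicator {0..} t \<partial>lborel)"
    by (rule nn_integral_abs_le) simp
  also have "(\<integral>\<^sup>+t. ennreal ((1 + t) powr (-s)) * indicator {0..} t \<partial>lborel)
    \<le> (\<integral>\<^sup>+t. indicator {0..<1} t + ennreal (t powr (-s)) * indicator {1..} t \<partial>lborel)"
  proof (intro nn_integral_mono)
    fix t :: real
    have "(1 + t) powr (-s) \<le> t powr (-s)" if "t \<ge> 1"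
      using that assms by (intro powr_mono2') auto
    moreover have "(1 + t) powr (-s) \<le> 1" if "t \<ge> 0"
      using that assms powr_mono2'[of "-s" 1 "1+t"] by simp
    ultimately show "ennreal ((1 + t) powr (-s)) * indicator {0..} t
       \<le> indicator {0..<1} t + ennreal (t powr (-s)) * indicator {1..} t"
      by (auto simp: indicator_def add_increasing intro!: ennreal_leI)
  qed
  also have "\<dots> = (\<integral>\<^sup>+t. indicator {0..<1::real} t \<partial>lborel) + (\<integral>\<^sup>+t. ennreal (t powr (-s)) * indicator {1..} t \<partial>lborel)"
    by (intro nn_integral_add) auto
  also have "2 * \<dots> < \<infinity>"
    using a by (auto simp: ennreal_mult_less_top)
  finally show ?thesis by (simp add: mult_left_mono)
qed

lemma std_normal_density_le_1: "std_normal_density x \<le> 1"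
proof -
  have "1 \<le> sqrt (2 * pi)" using pi_gt3 by (simp add: real_le_rsqrt)
  then show ?thesis
    unfolding std_normal_density_def by (auto simp: divide_simps intro: order_trans[of _ 1])
qed

lemma nn_integral_std_normal_le:
  assumes [measurable]: "f \<in> borel_measurable borel"
  shows "(\<integral>\<^sup>+t. f t \<partial>std_normal_distribution) \<le> (\<integral>\<^sup>+t. f t \<partial>lborel)"
proof -
  have "ennreal (std_normal_density t) * f t \<le> 1 * f t" for t
    using std_normal_density_le_1 by (intro mult_right_mono) (auto simp: ennreal_le_1)
  then show ?thesis by (simp add: nn_integral_density nn_integral_mono)
qed

text \<open>On |t| \<le> 1 the density is at most 1 and g < 1 makes the power integrable at 0; on
  |t| \<ge> 1 the integrand is at most 1 and the total mass is 1.\<close>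

lemma nn_integral_normal_powr_finite:
  fixes g :: real assumes "0 \<le> g" "g < 1"
  shows "(\<integral>\<^sup>+t. ennreal (\<bar>t\<bar> powr (-g)) \<partial>std_normal_distribution) < \<infinity>"
proof -
  interpret N: prob_space std_normal_distribution
    using prob_space_normal_density[of 1 0] by simp
  have a: "(\<integral>\<^sup>+t. ennreal (t powr (-g)) * indicator {0..1} t \<partial>lborel) < \<infinity>"
    using nn_integral_has_integral_lebesgue'[OF _ has_integral_powr_from_0[of "-g" 1]] assms by simp
  have "(\<integral>\<^sup>+t. ennreal (\<bar>t\<bar> powr (-g)) \<partial>std_normal_distribution)
     \<le> (\<integral>\<^sup>+t. ennreal (\<bar>t\<bar> powr (-g)) * indicator {0..1} \<bar>t\<bar> + 1 \<partial>std_normal_distribution)"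
  proof (intro nn_integral_mono)
    fix t :: real
    have "\<bar>t\<bar> powr (-g) \<le> 1" if "\<bar>t\<bar> \<ge> 1"
      using powr_mono2'[of "-g" 1 "\<bar>t\<bar>"] that assms by simp
    then show "ennreal (\<bar>t\<bar> powr (-g)) \<le> ennreal (\<bar>t\<bar> powr (-g)) * indicator {0..1} \<bar>t\<bar> + 1"
      by (auto simp: indicator_def add_increasing2)
  qed
  also have "\<dots> = (\<integral>\<^sup>+t. ennreal (\<bar>t\<bar> powr (-g)) * indicator {0..1} \<bar>t\<bar> \<partial>std_normal_distribution) + 1"
    using N.emeasure_space_1 by (subst nn_integral_add) auto
  also have "(\<integral>\<^sup>+t. ennreal (\<bar>t\<bar> powr (-g)) * indicator {0..1} \<bar>t\<bar> \<partial>std_normal_distribution)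
     \<le> (\<integral>\<^sup>+t. ennreal (\<bar>t\<bar> powr (-g)) * indicator {0..1} \<bar>t\<bar> \<partial>lborel)"
    by (rule nn_integral_std_normal_le) simp
  also have "\<dots> \<le> 2 * (\<integral>\<^sup>+t. ennreal (t powr (-g)) * indicator {0..1} t * indicator {0..} t \<partial>lborel)"
    by (rule nn_integral_abs_le) simp
  also have "(\<integral>\<^sup>+t. ennreal (t powr (-g)) * indicator {0..1} t * indicator {0..} t \<partial>lborel)
      = (\<integral>\<^sup>+t. ennreal (t powr (-g)) * indicator {0..1} t \<partial>lborel)"
    by (intro nn_integral_cong) (auto simp: indicator_def)
  also have "2 * \<dots> + 1 < \<infinity>"
    using a by (auto simp: ennreal_mult_less_top)
  finally show ?thesis by (simp add: mult_left_mono add_right_mono)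
qed

text \<open>Normalised like the characteristic function of probability theory, so that the one of
  the normal law applies without factors of 2 pi.\<close>

definition fourier_decay :: "'a::euclidean_space measure \<Rightarrow> real \<Rightarrow> real \<Rightarrow> bool" where
  "fourier_decay \<mu> s C \<longleftrightarrow> (\<forall>v. cmod (\<integral>y. iexp (y \<bullet> v) \<partial>\<mu>) \<le> C * (1 + norm v) powr (-s))"

lemma fourier_decay_fourier_measure:
  fixes \<mu> :: "'a::euclidean_space measure"
  assumes "\<And>\<xi>. cmod (fourier_measure \<mu> \<xi>) \<le> C * (1 + norm \<xi>) powr (-s)" "s \<ge> 0"
  shows "fourier_decay \<mu> s (C * (2 * pi) powr s)"
  unfolding fourier_decay_def
proof
  fix v :: 'a
  have "0 \<le> C * (1 + norm (0::'a)) powr (-s)"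
    using assms(1)[of 0] norm_ge_zero order_trans by blast
  then have C: "C \<ge> 0" by simp
  let ?\<xi> = "(- 1 / (2 * pi)) *\<^sub>R v"
  have "(\<integral>y. iexp (y \<bullet> v) \<partial>\<mu>) = fourier_measure \<mu> ?\<xi>"
    unfolding fourier_measure_def by (intro Bochner_Integration.integral_cong) auto
  \<comment> \<open>Since 2 pi > 1, the number 1 + |v| / (2 pi) is at least (1 + |v|) / (2 pi), and
    the exponent is nonpositive; this is the origin of the factor (2 pi)^s.\<close>
  moreover have "(1 + norm ?\<xi>) powr (-s) \<le> ((1 + norm v) / (2 * pi)) powr (-s)"
    using assms(2) pi_gt3 by (intro powr_mono2') (auto simp: divide_simps intro!: add_pos_nonneg)
  moreover have "((1 + norm v) / (2 * pi)) powr (-s) = (2 * pi) powr s * (1 + norm v) powr (-s)"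
    by (subst powr_divide) (auto simp: powr_minus field_simps)
  ultimately show "cmod (\<integral>y. iexp (y \<bullet> v) \<partial>\<mu>) \<le> C * (2 * pi) powr s * (1 + norm v) powr (-s)"
    using assms(1)[of ?\<xi>] C by (smt (verit, best) mult.assoc mult_left_mono)
qed

lemma fourier_decay_nonneg: "fourier_decay \<mu> s C \<Longrightarrow> C \<ge> 0"
  unfolding fourier_decay_def
  by (metis (no_types, lifting) add.right_neutral mult.right_neutral norm_ge_zero norm_zero order_trans powr_one_eq_one)

text \<open>Replace the indicator of the slab by a Gaussian and write the Gaussian as its own
  Fourier transform.\<close>

lemma fourier_decay_slab:
  fixes \<mu> :: "'a::euclidean_space measure"
  assumes \<mu>: "prob_space \<mu>" "sets \<mu> = sets borel" and dec: "fourier_decay \<mu> s C" and s: "s > 1"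
  obtains K where "K \<ge> 0"
    "\<And>w c \<rho>. w \<noteq> 0 \<Longrightarrow> \<rho> > 0 \<Longrightarrow> emeasure \<mu> {y. \<bar>y \<bullet> w - c\<bar> \<le> \<rho>} \<le> ennreal (K * \<rho> / norm w)"
proof -
  interpret prob_space \<mu> by fact
  interpret N: prob_space std_normal_distribution
    using prob_space_normal_density[of 1 0] by simp
  interpret P: pair_prob_space \<mu> std_normal_distribution ..
  note \<mu>(2)[measurable_cong]
  obtain K0 where K0: "K0 \<ge> 0" "(\<integral>\<^sup>+t. ennreal ((1 + \<bar>t\<bar>) powr (-s)) \<partial>lborel) = ennreal K0"
    using nn_integral_decay_finite[OF s] by (cases "(\<integral>\<^sup>+t. ennreal ((1 + \<bar>t\<bar>) powr (-s)) \<partial>lborel)") auto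
  have C: "C \<ge> 0" using dec by (rule fourier_decay_nonneg)
  \<comment> \<open>\<open>exp (1/2)\<close> compensates for the smallest value of the Gaussian on
    the slab, \<open>C\<close> comes from the decay, and \<open>K0\<close> is the total integral of
    the decay profile on the line.\<close>
  have "emeasure \<mu> {y. \<bar>y \<bullet> w - c\<bar> \<le> \<rho>} \<le> ennreal (exp (1/2) * C * K0 * \<rho> / norm w)"
    if w: "w \<noteq> 0" and \<rho>: "\<rho> > 0" for w c \<rho>
  proof -
    let ?t = "\<lambda>y. (y \<bullet> w - c) / \<rho>"
    define G where "G y = exp (- (?t y)\<^sup>2 / 2)" for y
    have [measurable]: "G \<in> borel_measurable borel" unfolding G_def by measurable
    have Gpos: "AE y in \<mu>. 0 \<le> G y" by (simp add: G_def)
    have Gint: "integrable \<mu> G"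
      by (rule integrable_const_bound[of _ 1]) (auto simp: G_def)
    have "complex_of_real (\<integral>y. G y \<partial>\<mu>) = (\<integral>y. (\<integral>g. iexp (?t y * g) \<partial>std_normal_distribution) \<partial>\<mu>)"
    proof -
      have "(\<integral>g. iexp (?t y * g) \<partial>std_normal_distribution) = complex_of_real (G y)" for y
        using fun_cong[OF char_std_normal_distribution, of "?t y"] by (simp add: char_def G_def)
      then show ?thesis by simp
    qed
    also have "\<dots> = (\<integral>g. (\<integral>y. iexp (?t y * g) \<partial>\<mu>) \<partial>std_normal_distribution)"
      by (rule P.Fubini_integral[symmetric], rule P.integrable_const_bound[of _ 1]) auto
    also have "\<dots> = (\<integral>g. iexp (- c * g / \<rho>) * (\<integral>y. iexp (y \<bullet> ((g / \<rho>) *\<^sub>R w)) \<partial>\<mu>) \<partial>std_normal_distribution)"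
      by (intro Bochner_Integration.integral_cong refl)
         (auto simp: exp_add[symmetric] algebra_simps diff_divide_distrib add_divide_distrib simp flip: integral_mult_right_zero
            intro!: Bochner_Integration.integral_cong arg_cong[of _ _ exp])
    also have "ennreal (cmod \<dots>) \<le> (\<integral>\<^sup>+g. norm (iexp (- c * g / \<rho>) * (\<integral>y. iexp (y \<bullet> ((g / \<rho>) *\<^sub>R w)) \<partial>\<mu>)) \<partial>std_normal_distribution)"
    proof (rule integral_norm_bound_ennreal, rule N.integrable_const_bound[of _ C])
      show "AE g in std_normal_distribution. norm (iexp (- c * g / \<rho>) * (\<integral>y. iexp (y \<bullet> ((g / \<rho>) *\<^sub>R w)) \<partial>\<mu>)) \<le> C"
      proof (intro AE_I2)
        fix g
        have "cmod (\<integral>y. iexp (y \<bullet> ((g / \<rho>) *\<^sub>R w)) \<partial>\<mu>) \<le> C * (1 + norm ((g / \<rho>) *\<^sub>R w)) powr (-s)"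
          using dec unfolding fourier_decay_def by blast
        also have "\<dots> \<le> C * 1"
          using C s powr_mono2'[of "-s" 1 "1 + norm ((g / \<rho>) *\<^sub>R w)"] by (intro mult_left_mono) auto
        finally show "norm (iexp (- c * g / \<rho>) * (\<integral>y. iexp (y \<bullet> ((g / \<rho>) *\<^sub>R w)) \<partial>\<mu>)) \<le> C"
          by (simp add: norm_mult)
      qed
    qed measurable
    also have "\<dots> \<le> (\<integral>\<^sup>+g. ennreal (C * (1 + \<bar>norm w / \<rho> * g\<bar>) powr (-s)) \<partial>std_normal_distribution)"
    proof (intro nn_integral_mono ennreal_leI)
      fix g
      have "cmod (\<integral>y. iexp (y \<bullet> ((g / \<rho>) *\<^sub>R w)) \<partial>\<mu>) \<le> C * (1 + norm ((g / \<rho>) *\<^sub>R w)) powr (-s)"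
        using dec unfolding fourier_decay_def by blast
      then show "norm (iexp (- c * g / \<rho>) * (\<integral>y. iexp (y \<bullet> ((g / \<rho>) *\<^sub>R w)) \<partial>\<mu>)) \<le> C * (1 + \<bar>norm w / \<rho> * g\<bar>) powr (-s)"
        using \<rho> by (simp add: norm_mult abs_mult field_simps)
    qed
    \<comment> \<open>The Gaussian weight is discarded: with s > 1 the decay of \<mu> alone makes
      the integral converge, and the substitution t = (|w| / \<rho>) g then produces exactly the
      factor \<rho> / |w|.\<close>
    also have "\<dots> \<le> (\<integral>\<^sup>+g. ennreal (C * (1 + \<bar>norm w / \<rho> * g\<bar>) powr (-s)) \<partial>lborel)"
      by (rule nn_integral_std_normal_le) simp
    also have "\<dots> = ennreal C * (\<integral>\<^sup>+g. ennreal ((1 + \<bar>norm w / \<rho> * g\<bar>) powr (-s)) \<partial>lborel)"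
      using C by (subst nn_integral_cmult[symmetric]) (auto simp: ennreal_mult)
    also have "(\<integral>\<^sup>+g. ennreal ((1 + \<bar>norm w / \<rho> * g\<bar>) powr (-s)) \<partial>lborel) = ennreal (\<rho> / norm w) * ennreal K0"
    proof -
      have "ennreal K0 = ennreal (norm w / \<rho>) * (\<integral>\<^sup>+g. ennreal ((1 + \<bar>norm w / \<rho> * g\<bar>) powr (-s)) \<partial>lborel)"
        unfolding K0(2)[symmetric]
        using w \<rho> nn_integral_real_affine[of "\<lambda>t. ennreal ((1 + \<bar>t\<bar>) powr (-s))" "norm w / \<rho>" 0] by simp
      moreover have "ennreal (\<rho> / norm w) * ennreal (norm w / \<rho>) = 1"
        using w \<rho> by (simp flip: ennreal_mult)
      ultimately show ?thesis by (metis mult.assoc mult.left_neutral)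
    qed
    finally have *: "ennreal (\<integral>y. G y \<partial>\<mu>) \<le> ennreal (C * K0 * \<rho> / norm w)"
      using C K0 w \<rho>
      by (simp add: ennreal_mult[symmetric] integral_nonneg_AE G_def mult_ac)
    have "emeasure \<mu> {y. \<bar>y \<bullet> w - c\<bar> \<le> \<rho>} = (\<integral>\<^sup>+y. indicator {y. \<bar>y \<bullet> w - c\<bar> \<le> \<rho>} y \<partial>\<mu>)"
      by (subst nn_integral_indicator) (auto simp: \<mu>(2))
    also have "\<dots> \<le> (\<integral>\<^sup>+y. ennreal (exp (1/2)) * ennreal (G y) \<partial>\<mu>)"
    proof (intro nn_integral_mono)
      fix y
      have "1 \<le> exp (1/2) * G y" if "\<bar>y \<bullet> w - c\<bar> \<le> \<rho>"
      proof -
        have "\<bar>?t y\<bar> \<le> 1" using that \<rho> by simp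
        then have "(?t y)\<^sup>2 \<le> 1" by (simp add: abs_square_le_1)
        then show ?thesis unfolding G_def exp_add[symmetric] by simp
      qed
      then show "indicator {y. \<bar>y \<bullet> w - c\<bar> \<le> \<rho>} y \<le> ennreal (exp (1/2)) * ennreal (G y)"
        by (auto simp: indicator_def ennreal_mult[symmetric] G_def)
    qed
    also have "\<dots> = ennreal (exp (1/2)) * ennreal (\<integral>y. G y \<partial>\<mu>)"
      by (simp add: nn_integral_cmult nn_integral_eq_integral[OF Gint Gpos])
    also have "\<dots> \<le> ennreal (exp (1/2)) * ennreal (C * K0 * \<rho> / norm w)"
      by (intro mult_left_mono *) auto
    finally show ?thesis
      using C K0 \<rho> by (simp add: ennreal_mult[symmetric] mult_ac)
  qed
  then show thesis using C K0 by (intro that[of "exp (1/2) * C * K0"]) auto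
qed

section \<open>Concentration of the product measure near the diagonal\<close>

lemma fourier_decay_le: "fourier_decay \<mu> s C \<Longrightarrow> s \<ge> 0 \<Longrightarrow> cmod (\<integral>y. iexp (y \<bullet> v) \<partial>\<mu>) \<le> C"
proof -
  assume a: "fourier_decay \<mu> s C" "s \<ge> 0"
  have "cmod (\<integral>y. iexp (y \<bullet> v) \<partial>\<mu>) \<le> C * (1 + norm v) powr (-s)"
    using a(1) unfolding fourier_decay_def by blast
  also have "\<dots> \<le> C * 1"
    using fourier_decay_nonneg[OF a(1)] a(2) powr_mono2'[of "-s" 1 "1 + norm v"] by (intro mult_left_mono) auto
  finally show ?thesis by simp
qed

text \<open>The exponential of an inner product factorises over coordinates, and independence
  reduces the claim to the characteristic function of one normal variable. The product over
  \<open>Basis\<close> stands for the Gaussian measure on the space itself.\<close>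

lemma gaussian_eq_integral_iexp:
  fixes w :: "'a::euclidean_space"
  shows "complex_of_real (exp (- (norm w)\<^sup>2 / 2))
    = (\<integral>g. iexp (w \<bullet> (\<Sum>b\<in>Basis. g b *\<^sub>R b)) \<partial>(Pi\<^sub>M Basis (\<lambda>_. std_normal_distribution)))"
proof -
  interpret N: prob_space std_normal_distribution
    using prob_space_normal_density[of 1 0] by simp
  interpret product_prob_space "\<lambda>_::'a. std_normal_distribution" ..
  have "(norm w)\<^sup>2 = (\<Sum>b\<in>Basis. (w \<bullet> b)\<^sup>2)"
    by (simp add: norm_eq_sqrt_inner euclidean_inner[of w w] power2_eq_square sum_nonneg)
  then have "complex_of_real (exp (- (norm w)\<^sup>2 / 2)) = (\<Prod>b\<in>Basis. complex_of_real (exp (- (w \<bullet> b)\<^sup>2 / 2)))"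
    by (simp add: exp_sum[symmetric] sum_negf sum_divide_distrib flip: of_real_prod)
  also have "\<dots> = (\<Prod>b\<in>Basis. \<integral>g. iexp ((w \<bullet> b) * g) \<partial>std_normal_distribution)"
    using char_std_normal_distribution by (simp add: char_def fun_eq_iff)
  also have "\<dots> = (\<integral>g. (\<Prod>b\<in>Basis. iexp ((w \<bullet> b) * g b)) \<partial>(Pi\<^sub>M Basis (\<lambda>_. std_normal_distribution)))"
    by (rule product_integral_prod[symmetric]) (auto intro!: N.integrable_const_bound[of _ 1])
  also have "\<dots> = (\<integral>g. iexp (w \<bullet> (\<Sum>b\<in>Basis. g b *\<^sub>R b)) \<partial>(Pi\<^sub>M Basis (\<lambda>_. std_normal_distribution)))"
    by (intro Bochner_Integration.integral_cong refl)
       (simp add: exp_sum[symmetric] inner_sum_right sum_distrib_left mult_ac)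
  finally show ?thesis .
qed

text \<open>Each coordinate is at most the norm, so each of the DIM equal factors on the left can
  only grow. This turns radial decay into a product, which integrates coordinate by coordinate
  against a Gaussian.\<close>

lemma powr_norm_le_prod:
  fixes v :: "'a::euclidean_space" and g :: real
  assumes "g \<ge> 0"
  shows "(1 + norm v) powr (- g * DIM('a)) \<le> (\<Prod>b\<in>Basis. (1 + \<bar>v \<bullet> b\<bar>) powr (-g))"
proof -
  have "1 + norm v \<noteq> 0" using norm_ge_zero[of v] by linarith
  then have "(1 + norm v) powr (- g * DIM('a)) = (\<Prod>b\<in>(Basis::'a set). (1 + norm v) powr (-g))"
    by (simp add: powr_power[of "1 + norm v" "-g" "DIM('a)"] mult.commute)
  also have "\<dots> \<le> (\<Prod>b\<in>Basis. (1 + \<bar>v \<bullet> b\<bar>) powr (-g))"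
    using assms by (intro prod_mono conjI powr_mono2') (auto simp: Basis_le_norm add_pos_nonneg)
  finally show ?thesis .
qed

lemma nn_integral_normal_decay:
  fixes g :: real assumes "0 \<le> g" "g < 1"
  obtains K where "K \<ge> 0" "\<And>r. r > 0 \<Longrightarrow>
    (\<integral>\<^sup>+t. ennreal ((1 + \<bar>t / r\<bar>) powr (-g)) \<partial>std_normal_distribution) \<le> ennreal (K * r powr g)"
proof -
  obtain K where K: "K \<ge> 0" "(\<integral>\<^sup>+t. ennreal (\<bar>t\<bar> powr (-g)) \<partial>std_normal_distribution) = ennreal K"
    using nn_integral_normal_powr_finite[OF assms]
    by (cases "\<integral>\<^sup>+t. ennreal (\<bar>t\<bar> powr (-g)) \<partial>std_normal_distribution") auto
  have "(\<integral>\<^sup>+t. ennreal ((1 + \<bar>t / r\<bar>) powr (-g)) \<partial>std_normal_distribution) \<le> ennreal (K * r powr g)"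
    if "r > 0" for r
  proof -
    \<comment> \<open>The point 0 has to be removed: \<open>0 powr (-g)\<close> is 0 by convention,
      so the pointwise bound fails there.\<close>
    have "AE t in std_normal_distribution. t \<noteq> (0::real)"
      by (subst AE_density) (use AE_lborel_singleton[of "0::real"] in auto)
    then have "(\<integral>\<^sup>+t. ennreal ((1 + \<bar>t / r\<bar>) powr (-g)) \<partial>std_normal_distribution)
       \<le> (\<integral>\<^sup>+t. ennreal (r powr g) * ennreal (\<bar>t\<bar> powr (-g)) \<partial>std_normal_distribution)"
    proof (intro nn_integral_mono_AE, eventually_elim)
      fix t :: real assume "t \<noteq> 0"
      then have "(1 + \<bar>t / r\<bar>) powr (-g) \<le> \<bar>t / r\<bar> powr (-g)"
        using assms that by (intro powr_mono2') auto
      also have "\<dots> = r powr g * \<bar>t\<bar> powr (-g)"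
        using that by (simp add: abs_divide powr_divide powr_minus field_simps)
      finally show "ennreal ((1 + \<bar>t / r\<bar>) powr (-g)) \<le> ennreal (r powr g) * ennreal (\<bar>t\<bar> powr (-g))"
        by (simp add: ennreal_mult[symmetric] ennreal_leI)
    qed
    also have "\<dots> = ennreal (K * r powr g)"
      using K by (subst nn_integral_cmult) (auto simp: ennreal_mult mult_ac)
    finally show ?thesis .
  qed
  with K(1) show thesis by (rule that)
qed

text \<open>The law of y - y' has Fourier transform equal to the product of the transforms of \<mu>
  at v and at -v, hence decay of order 2s. Bounding the indicator of the r-ball by a Gaussian and
  averaging this decay over Gaussian frequencies of size 1/r gives r^(2s).\<close>

lemma fourier_decay_pair:
  fixes \<mu> :: "'a::euclidean_space measure"
  assumes \<mu>: "prob_space \<mu>" "sets \<mu> = sets borel" and dec: "fourier_decay \<mu> s C"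
    and s: "0 \<le> s" "2 * s < DIM('a)"
  obtains K where "K \<ge> 0"
    "\<And>r. r > 0 \<Longrightarrow> emeasure (\<mu> \<Otimes>\<^sub>M \<mu>) {p. norm (fst p - snd p) \<le> r} \<le> ennreal (K * r powr (2 * s))"
proof -
  \<comment> \<open>The decay exponent 2s is shared equally among the coordinates; 2s < d is exactly
    g < 1, the integrability condition in each of them.\<close>
  define g where "g = 2 * s / DIM('a)"
  have g: "0 \<le> g" "g < 1" using s by (auto simp: g_def)
  obtain K1 where K1: "K1 \<ge> 0" "\<And>r. r > 0 \<Longrightarrow>
    (\<integral>\<^sup>+t. ennreal ((1 + \<bar>t / r\<bar>) powr (-g)) \<partial>std_normal_distribution) \<le> ennreal (K1 * r powr g)"
    using nn_integral_normal_decay[OF g] by blast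
  interpret prob_space \<mu> by fact
  interpret N1: prob_space std_normal_distribution
    using prob_space_normal_density[of 1 0] by simp
  interpret PN: product_prob_space "\<lambda>_::'a. std_normal_distribution" ..
  define N where "N = Pi\<^sub>M (Basis::'a set) (\<lambda>_. std_normal_distribution)"
  interpret N: prob_space N unfolding N_def by (intro prob_space_PiM N1.prob_space_axioms)
  interpret M2: pair_prob_space \<mu> \<mu> ..
  interpret P: pair_prob_space "\<mu> \<Otimes>\<^sub>M \<mu>" N ..
  note \<mu>(2)[measurable_cong]
  define X :: "('a \<Rightarrow> real) \<Rightarrow> 'a" where "X f = (\<Sum>b\<in>Basis. f b *\<^sub>R b)" for f
  have X[measurable]: "X \<in> borel_measurable N"
    unfolding X_def N_def by measurable
  have Xb: "X f \<bullet> b = f b" if "b \<in> Basis" for f b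
    using that by (simp add: X_def)
  have C: "C \<ge> 0" using dec by (rule fourier_decay_nonneg)
  have sp: "space (\<mu> \<Otimes>\<^sub>M \<mu>) = UNIV"
    using sets_eq_imp_space_eq[OF \<mu>(2)] by (simp add: space_pair_measure)
  have "emeasure (\<mu> \<Otimes>\<^sub>M \<mu>) {p. norm (fst p - snd p) \<le> r} \<le> ennreal (exp (1/2) * C\<^sup>2 * K1 ^ DIM('a) * r powr (2 * s))"
    if r: "r > 0" for r
  proof -
    define w where "w p = (1 / r) *\<^sub>R (fst p - snd p :: 'a)" for p
    have w[measurable]: "w \<in> borel_measurable (\<mu> \<Otimes>\<^sub>M \<mu>)"
      unfolding w_def by measurable
    define G where "G p = exp (- (norm (w p))\<^sup>2 / 2)" for p
    have [measurable]: "G \<in> borel_measurable (\<mu> \<Otimes>\<^sub>M \<mu>)"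
      unfolding G_def by measurable
    have Gpos: "AE p in \<mu> \<Otimes>\<^sub>M \<mu>. 0 \<le> G p" by (simp add: G_def)
    have Gint: "integrable (\<mu> \<Otimes>\<^sub>M \<mu>) G"
      by (rule M2.integrable_const_bound[of _ 1]) (auto simp: G_def)
    \<comment> \<open>Independence of y and y' splits the transform of the difference, which is why
      the decay can be used twice.\<close>
    have split: "(\<integral>p. iexp (w p \<bullet> X f) \<partial>(\<mu> \<Otimes>\<^sub>M \<mu>))
        = (\<integral>y. iexp (y \<bullet> ((1 / r) *\<^sub>R X f)) \<partial>\<mu>) * (\<integral>y. iexp (y \<bullet> (- (1 / r) *\<^sub>R X f)) \<partial>\<mu>)" for f
    proof -
      have "(\<integral>p. iexp (w p \<bullet> X f) \<partial>(\<mu> \<Otimes>\<^sub>M \<mu>))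
         = (\<integral>p. (case p of (y, y') \<Rightarrow> iexp (y \<bullet> ((1 / r) *\<^sub>R X f)) * iexp (y' \<bullet> (- (1 / r) *\<^sub>R X f))) \<partial>(\<mu> \<Otimes>\<^sub>M \<mu>))"
        by (intro Bochner_Integration.integral_cong refl)
           (auto simp: w_def exp_add[symmetric] inner_diff_left diff_divide_distrib algebra_simps)
      also have "\<dots> = (\<integral>y. \<integral>y'. iexp (y \<bullet> ((1 / r) *\<^sub>R X f)) * iexp (y' \<bullet> (- (1 / r) *\<^sub>R X f)) \<partial>\<mu> \<partial>\<mu>)"
        by (rule M2.integral_fst[symmetric], rule M2.integrable_const_bound[of _ 1]) (auto simp: norm_mult)
      finally show ?thesis by simp
    qed
    have "complex_of_real (\<integral>p. G p \<partial>(\<mu> \<Otimes>\<^sub>M \<mu>)) = (\<integral>p. (\<integral>f. iexp (w p \<bullet> X f) \<partial>N) \<partial>(\<mu> \<Otimes>\<^sub>M \<mu>))"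
      unfolding G_def X_def N_def gaussian_eq_integral_iexp[symmetric] by simp
    also have "\<dots> = (\<integral>f. (\<integral>p. iexp (w p \<bullet> X f) \<partial>(\<mu> \<Otimes>\<^sub>M \<mu>)) \<partial>N)"
      by (rule P.Fubini_integral[symmetric], rule P.integrable_const_bound[of _ 1]) auto
    also have "ennreal (cmod \<dots>) \<le> (\<integral>\<^sup>+f. norm (\<integral>p. iexp (w p \<bullet> X f) \<partial>(\<mu> \<Otimes>\<^sub>M \<mu>)) \<partial>N)"
    proof (rule integral_norm_bound_ennreal, rule N.integrable_const_bound[of _ "C * C"])
      show "AE f in N. norm (\<integral>p. iexp (w p \<bullet> X f) \<partial>(\<mu> \<Otimes>\<^sub>M \<mu>)) \<le> C * C"
        unfolding split norm_mult
        by (intro AE_I2 mult_mono fourier_decay_le[OF dec s(1)] C norm_ge_zero)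
    qed measurable
    also have "\<dots> \<le> (\<integral>\<^sup>+f. ennreal (C\<^sup>2) * (\<Prod>b\<in>Basis. ennreal ((1 + \<bar>f b / r\<bar>) powr (-g))) \<partial>N)"
    proof (intro nn_integral_mono)
      fix f
      let ?v = "(1 / r) *\<^sub>R X f"
      have n: "norm (- (1 / r) *\<^sub>R X f) = norm ?v" by simp
      have "norm (\<integral>p. iexp (w p \<bullet> X f) \<partial>(\<mu> \<Otimes>\<^sub>M \<mu>))
          \<le> (C * (1 + norm ?v) powr (-s)) * (C * (1 + norm ?v) powr (-s))"
        unfolding split norm_mult
      proof (rule mult_mono)
        show "cmod (\<integral>y. iexp (y \<bullet> ?v) \<partial>\<mu>) \<le> C * (1 + norm ?v) powr (-s)"
          using dec unfolding fourier_decay_def by blast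
        show "cmod (\<integral>y. iexp (y \<bullet> (- (1 / r) *\<^sub>R X f)) \<partial>\<mu>) \<le> C * (1 + norm ?v) powr (-s)"
          using dec unfolding fourier_decay_def n[symmetric] by blast
      qed (use C in auto)
      also have "\<dots> = C\<^sup>2 * (1 + norm ?v) powr (- g * DIM('a))"
        by (simp add: g_def power2_eq_square powr_add[symmetric] mult_ac)
      also have "\<dots> \<le> C\<^sup>2 * (\<Prod>b\<in>Basis. (1 + \<bar>?v \<bullet> b\<bar>) powr (-g))"
        by (intro mult_left_mono powr_norm_le_prod g) auto
      also have "(\<Prod>b\<in>Basis. (1 + \<bar>?v \<bullet> b\<bar>) powr (-g)) = (\<Prod>b\<in>Basis. (1 + \<bar>f b / r\<bar>) powr (-g))"
        by (intro prod.cong) (auto simp: Xb)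
      finally show "ennreal (norm (\<integral>p. iexp (w p \<bullet> X f) \<partial>(\<mu> \<Otimes>\<^sub>M \<mu>)))
          \<le> ennreal (C\<^sup>2) * (\<Prod>b\<in>Basis. ennreal ((1 + \<bar>f b / r\<bar>) powr (-g)))"
        by (subst prod_ennreal) (auto simp: ennreal_mult[symmetric] prod_nonneg ennreal_leI)
    qed
    also have "\<dots> = ennreal (C\<^sup>2) * (\<Prod>b\<in>(Basis::'a set). \<integral>\<^sup>+t. ennreal ((1 + \<bar>t / r\<bar>) powr (-g)) \<partial>std_normal_distribution)"
      unfolding N_def
      by (subst nn_integral_cmult, measurable, subst PN.product_nn_integral_prod) auto
    also have "\<dots> \<le> ennreal (C\<^sup>2) * (\<Prod>b\<in>(Basis::'a set). ennreal (K1 * r powr g))"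
      by (simp only: prod_constant, intro mult_left_mono power_mono K1(2) r) auto
    also have "\<dots> = ennreal (C\<^sup>2 * K1 ^ DIM('a) * r powr (2 * s))"
      using K1(1) r by (simp add: ennreal_power ennreal_mult[symmetric] power_mult_distrib powr_realpow[symmetric] powr_powr g_def mult_ac)
    finally have *: "ennreal (\<integral>p. G p \<partial>(\<mu> \<Otimes>\<^sub>M \<mu>)) \<le> ennreal (C\<^sup>2 * K1 ^ DIM('a) * r powr (2 * s))"
      by (simp add: integral_nonneg_AE G_def)
    have "emeasure (\<mu> \<Otimes>\<^sub>M \<mu>) {p. norm (fst p - snd p) \<le> r} = (\<integral>\<^sup>+p. indicator {p. norm (fst p - snd p) \<le> r} p \<partial>(\<mu> \<Otimes>\<^sub>M \<mu>))"
    proof (subst nn_integral_indicator)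
      have "{p \<in> space (\<mu> \<Otimes>\<^sub>M \<mu>). norm (fst p - snd p) \<le> r} \<in> sets (\<mu> \<Otimes>\<^sub>M \<mu>)" by measurable
      then show "{p. norm (fst p - snd p) \<le> r} \<in> sets (\<mu> \<Otimes>\<^sub>M \<mu>)" by (simp add: sp)
    qed simp
    also have "\<dots> \<le> (\<integral>\<^sup>+p. ennreal (exp (1/2)) * ennreal (G p) \<partial>(\<mu> \<Otimes>\<^sub>M \<mu>))"
    proof (intro nn_integral_mono)
      fix p :: "'a \<times> 'a"
      have "1 \<le> exp (1/2) * G p" if "norm (fst p - snd p) \<le> r"
      proof -
        have "norm (w p) \<le> 1" using that r by (simp add: w_def)
        then have "(norm (w p))\<^sup>2 \<le> 1" by (simp add: power_le_one)
        then show ?thesis unfolding G_def exp_add[symmetric] by simp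
      qed
      then show "indicator {p. norm (fst p - snd p) \<le> r} p \<le> ennreal (exp (1/2)) * ennreal (G p)"
        by (auto simp: indicator_def ennreal_mult[symmetric] G_def)
    qed
    also have "\<dots> = ennreal (exp (1/2)) * ennreal (\<integral>p. G p \<partial>(\<mu> \<Otimes>\<^sub>M \<mu>))"
      by (simp add: nn_integral_cmult nn_integral_eq_integral[OF Gint Gpos])
    also have "\<dots> \<le> ennreal (exp (1/2)) * ennreal (C\<^sup>2 * K1 ^ DIM('a) * r powr (2 * s))"
      by (intro mult_left_mono *) auto
    finally show ?thesis
      using C K1 r by (simp add: ennreal_mult[symmetric] mult_ac)
  qed
  then show thesis using C K1 by (intro that[of "exp (1/2) * C\<^sup>2 * K1 ^ DIM('a)"]) auto
qed

text \<open>For x < 1 the single term with (1/2)^(n+1) < x \<le> (1/2)^n dominates; the summand 1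
  takes care of x \<ge> 1.\<close>

lemma inverse_power_le_dyadic:
  fixes x :: real
  assumes "x > 0"
  shows "ennreal (1 / x ^ j) \<le> 1 + (\<Sum>n. ennreal (2 ^ (Suc n * j)) * indicator {..(1/2) ^ n} x)"
proof (cases "x \<ge> 1")
  case True
  then have "1 / x ^ j \<le> 1" by simp
  then show ?thesis by (metis add_increasing2 ennreal_le_1 zero_le)
next
  case False
  then have x: "0 < x" "x < 1" using assms by auto
  then obtain n where n: "(1/2) ^ Suc n < x" "x \<le> (1/2::real) ^ n"
  proof -
    \<comment> \<open>The least m with (1/2)^m < x is positive because x < 1, so n = m - 1 is the
      dyadic scale of x.\<close>
    obtain m where m: "(1/2::real) ^ m < x" "\<And>i. i < m \<Longrightarrow> \<not> (1/2::real) ^ i < x"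
      using real_arch_pow_inv[OF x(1), of "1/2"] exists_least_iff[of "\<lambda>m. (1/2::real) ^ m < x"] by auto
    have "m \<noteq> 0" using m(1) x by (intro notI) auto
    then obtain n where "m = Suc n" by (cases m) auto
    then show ?thesis using m by (intro that[of n]) (auto simp: not_less)
  qed
  have "1 / x ^ j \<le> 1 / ((1/2) ^ Suc n) ^ j"
    using x n(1) by (intro divide_left_mono power_mono mult_pos_pos) auto
  also have "\<dots> = 2 ^ (Suc n * j)" by (simp add: power_mult[symmetric] power_one_over del: power_Suc mult_Suc)
  finally have "ennreal (1 / x ^ j) \<le> ennreal (2 ^ (Suc n * j)) * indicator {..(1/2) ^ n} x"
    using n(2) by (simp add: ennreal_leI)
  also have "\<dots> \<le> (\<Sum>n. ennreal (2 ^ (Suc n * j)) * indicator {..(1/2) ^ n} x)"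
  proof -
    have "f n \<le> suminf f" for f :: "nat \<Rightarrow> ennreal"
      using sum_le_suminf[of f "{n}"] by simp
    then show ?thesis .
  qed
  finally show ?thesis by (simp add: add_increasing)
qed

text \<open>After the dyadic decomposition the ball estimate leaves a geometric series with ratio
  2^(j - t) < 1.\<close>

lemma energy_finite:
  fixes \<mu> :: "'a::euclidean_space measure"
  assumes \<mu>: "prob_space \<mu>" "sets \<mu> = sets borel"
    and K: "K \<ge> 0" "\<And>r. r > 0 \<Longrightarrow> emeasure (\<mu> \<Otimes>\<^sub>M \<mu>) {p. norm (fst p - snd p) \<le> r} \<le> ennreal (K * r powr t)"
    and j: "real j < t"
  shows "(\<integral>\<^sup>+p. ennreal (1 / norm (fst p - snd p) ^ j) \<partial>(\<mu> \<Otimes>\<^sub>M \<mu>)) < \<infinity>"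
    and "AE p in \<mu> \<Otimes>\<^sub>M \<mu>. fst p \<noteq> snd p"
proof -
  interpret prob_space \<mu> by fact
  interpret M2: pair_prob_space \<mu> \<mu> ..
  note \<mu>(2)[measurable_cong]
  have sp: "space (\<mu> \<Otimes>\<^sub>M \<mu>) = UNIV"
    using sets_eq_imp_space_eq[OF \<mu>(2)] by (simp add: space_pair_measure)
  let ?S = "\<lambda>r::real. {p::'a \<times> 'a. norm (fst p - snd p) \<le> r}"
  have S: "?S r \<in> sets (\<mu> \<Otimes>\<^sub>M \<mu>)" for r
  proof -
    have "{p \<in> space (\<mu> \<Otimes>\<^sub>M \<mu>). norm (fst p - snd p) \<le> r} \<in> sets (\<mu> \<Otimes>\<^sub>M \<mu>)" by measurable
    then show ?thesis by (simp add: sp)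
  qed
  define q where "q = 2 powr (real j - t)"
  have q: "0 \<le> q" "q < 1" using j by (auto simp: q_def powr_less_one)
  have e: "ennreal (2 ^ (Suc n * j)) * emeasure (\<mu> \<Otimes>\<^sub>M \<mu>) (?S ((1/2) ^ n)) \<le> ennreal (2 ^ j * K * q ^ n)" for n
  proof -
    have "((1/2::real) ^ n) powr t = (2 powr (- t)) ^ n"
      by (simp add: powr_realpow[symmetric] powr_powr powr_minus_divide powr_divide mult.commute)
    moreover have "(2::real) ^ (Suc n * j) = 2 ^ j * (2 powr j) ^ n"
      by (simp add: power_add power_mult powr_realpow mult.commute[of n])
    ultimately have "2 ^ (Suc n * j) * (K * ((1/2) ^ n) powr t) = 2 ^ j * K * q ^ n"
      unfolding q_def by (simp add: powr_diff powr_minus_divide power_divide)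
    moreover have "ennreal (2 ^ (Suc n * j)) * emeasure (\<mu> \<Otimes>\<^sub>M \<mu>) (?S ((1/2) ^ n))
        \<le> ennreal (2 ^ (Suc n * j)) * ennreal (K * ((1/2) ^ n) powr t)"
      by (intro mult_left_mono K(2)) auto
    ultimately show ?thesis using K(1) by (simp only: ennreal_mult[symmetric] zero_le_power zero_le_numeral mult_nonneg_nonneg powr_ge_zero)
  qed
  show ae: "AE p in \<mu> \<Otimes>\<^sub>M \<mu>. fst p \<noteq> snd p"
  proof (rule AE_I[of _ _ "?S 0"])
    \<comment> \<open>The diagonal lies in every ball. Inserting the weight, which is at least 1,
      makes the terms of the geometric series bound its mass, and these tend to 0.\<close>
    have "emeasure (\<mu> \<Otimes>\<^sub>M \<mu>) (?S 0) \<le> ennreal (2 ^ j * K * q ^ n)" for n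
    proof -
      have "emeasure (\<mu> \<Otimes>\<^sub>M \<mu>) (?S 0) \<le> 1 * emeasure (\<mu> \<Otimes>\<^sub>M \<mu>) (?S ((1/2) ^ n))"
        using S by (auto intro!: emeasure_mono intro: order_trans[of _ 0])
      also have "\<dots> \<le> ennreal (2 ^ (Suc n * j)) * emeasure (\<mu> \<Otimes>\<^sub>M \<mu>) (?S ((1/2) ^ n))"
        by (intro mult_right_mono) (auto simp: one_le_power)
      finally show ?thesis using e[of n] by (rule order_trans)
    qed
    moreover have "(\<lambda>n. ennreal (2 ^ j * K * q ^ n)) \<longlonglongrightarrow> ennreal (2 ^ j * K * 0)"
      using q by (intro tendsto_ennrealI tendsto_mult_left LIMSEQ_realpow_zero)
    ultimately have "emeasure (\<mu> \<Otimes>\<^sub>M \<mu>) (?S 0) \<le> ennreal (2 ^ j * K * 0)"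
      by (intro LIMSEQ_le_const) auto
    then show "emeasure (\<mu> \<Otimes>\<^sub>M \<mu>) (?S 0) = 0" by simp
  qed (use S[of 0] in auto)
  have "(\<integral>\<^sup>+p. ennreal (1 / norm (fst p - snd p) ^ j) \<partial>(\<mu> \<Otimes>\<^sub>M \<mu>))
     \<le> (\<integral>\<^sup>+p. 1 + (\<Sum>n. ennreal (2 ^ (Suc n * j)) * indicator (?S ((1/2) ^ n)) p) \<partial>(\<mu> \<Otimes>\<^sub>M \<mu>))"
  proof (intro nn_integral_mono_AE, use ae in eventually_elim)
    fix p :: "'a \<times> 'a" assume "fst p \<noteq> snd p"
    then have "norm (fst p - snd p) > 0" by simp
    from inverse_power_le_dyadic[OF this, of j]
    show "ennreal (1 / norm (fst p - snd p) ^ j) \<le> 1 + (\<Sum>n. ennreal (2 ^ (Suc n * j)) * indicator (?S ((1/2) ^ n)) p)"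
      by (simp add: indicator_def cong: if_cong)
  qed
  also have "\<dots> = 1 + (\<Sum>n. \<integral>\<^sup>+p. ennreal (2 ^ (Suc n * j)) * indicator (?S ((1/2) ^ n)) p \<partial>(\<mu> \<Otimes>\<^sub>M \<mu>))"
    using S M2.emeasure_space_1 by (subst nn_integral_add) (auto simp: nn_integral_suminf)
  also have "\<dots> = 1 + (\<Sum>n. ennreal (2 ^ (Suc n * j)) * emeasure (\<mu> \<Otimes>\<^sub>M \<mu>) (?S ((1/2) ^ n)))"
    using S by (simp add: nn_integral_cmult_indicator)
  also have "\<dots> \<le> 1 + (\<Sum>n. ennreal (2 ^ j * K * q ^ n))"
    by (intro add_left_mono suminf_le e) auto
  also have "(\<Sum>n. ennreal (2 ^ j * K * q ^ n)) = ennreal (\<Sum>n. 2 ^ j * K * q ^ n)"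
    using q K(1) by (intro suminf_ennreal2 summable_mult summable_geometric) auto
  also have "1 + \<dots> < \<infinity>" by simp
  finally show "(\<integral>\<^sup>+p. ennreal (1 / norm (fst p - snd p) ^ j) \<partial>(\<mu> \<Otimes>\<^sub>M \<mu>)) < \<infinity>" .
qed

subsection \<open>A criterion for absolute continuity\<close>

text \<open>Bridge from the product sigma-algebra on extensional functions to the Borel sets of the
  full function space, where outer regularity and compactness are available. Coordinates outside I
  are constantly \<open>undefined\<close>, hence measurable.\<close>

lemma measurable_PiM_borel:
  fixes M :: "'i::countable \<Rightarrow> 'a::second_countable_topology measure"
  assumes M: "\<And>i. i \<in> I \<Longrightarrow> sets (M i) = sets borel"
  shows "(\<lambda>z. z) \<in> measurable (Pi\<^sub>M I M) borel"
proof (rule measurable_coordinatewise_then_product)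
  fix i
  show "(\<lambda>z. z i) \<in> borel_measurable (Pi\<^sub>M I M)"
  proof (cases "i \<in> I")
    case True
    then show ?thesis
      using measurable_component_singleton[of i I M] M[of i] measurable_cong_sets by blast
  next
    case False
    then have "(\<lambda>z. z i) \<in> borel_measurable (Pi\<^sub>M I M) \<longleftrightarrow> (\<lambda>z. undefined :: 'a) \<in> borel_measurable (Pi\<^sub>M I M)"
      by (intro measurable_cong) (auto simp: space_PiM PiE_def extensional_def)
    then show ?thesis by simp
  qed
qed

text \<open>Extensionality fixes all coordinates outside J, so a minimum over the finite set J is a
  common radius.\<close>

lemma open_fun_contains_box:
  fixes U :: "('i \<Rightarrow> real) set"
  assumes "open U" "u \<in> U" "finite J" "u \<in> extensional J"
  obtains \<delta> where "\<delta> > 0" "\<And>v. v \<in> extensional J \<Longrightarrow> (\<And>i. i \<in> J \<Longrightarrow> \<bar>u i - v i\<bar> < \<delta>) \<Longrightarrow> v \<in> U"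
proof -
  have "openin (product_topology (\<lambda>i. euclidean) UNIV) U"
    using assms(1) by (simp add: euclidean_product_topology)
  from product_topology_open_contains_basis[OF this assms(2)]
  obtain X where X: "u \<in> Pi\<^sub>E UNIV X" "\<And>i. open (X i)" "Pi\<^sub>E UNIV X \<subseteq> U"
    by auto
  have "\<forall>i. \<exists>d>0. \<forall>y. \<bar>u i - y\<bar> < d \<longrightarrow> y \<in> X i"
  proof
    fix i
    have "u i \<in> X i" using X(1) by auto
    with X(2)[of i] show "\<exists>d>0. \<forall>y. \<bar>u i - y\<bar> < d \<longrightarrow> y \<in> X i"
      unfolding open_dist dist_real_def by (metis abs_minus_commute)
  qed
  then obtain d where d: "\<And>i. d i > 0" "\<And>i y. \<bar>u i - y\<bar> < d i \<Longrightarrow> y \<in> X i" by metis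
  define \<delta> where "\<delta> = Min (insert 1 (d ` J))"
  have "\<delta> > 0" using assms(3) d(1) by (auto simp: \<delta>_def)
  moreover have "v \<in> U" if v: "v \<in> extensional J" "\<And>i. i \<in> J \<Longrightarrow> \<bar>u i - v i\<bar> < \<delta>" for v
  proof -
    have "v i \<in> X i" for i
    proof (cases "i \<in> J")
      case True
      then have "\<delta> \<le> d i" using assms(3) by (auto simp: \<delta>_def)
      then show ?thesis using v(2)[OF True] d(2) by fastforce
    next
      case False
      then have "v i = u i" using v(1) assms(4) by (simp add: extensional_def)
      then show ?thesis using X(1) by auto
    qed
    then show ?thesis using X(3) by auto
  qed
  ultimately show thesis by (rule that)
qed

text \<open>Either g \<le> a, or g \<le> g^2 / a. Integrated, this plays the role of the
  Cauchy-Schwarz inequality: the integral of g over U is controlled by the measure of U and the L2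
  norm of g.\<close>

lemma ennreal_mult_indicator_le:
  fixes g :: ennreal assumes a: "a > 0"
  shows "g * indicator U v \<le> ennreal a * indicator U v + ennreal (1 / a) * g\<^sup>2"
proof (cases "g \<le> ennreal a")
  case True
  then show ?thesis by (auto simp: indicator_def add_increasing2)
next
  case False
  have "g * 1 \<le> g * (ennreal (1 / a) * g)"
  proof (rule mult_left_mono)
    have "1 = ennreal (1 / a) * ennreal a" using a by (simp flip: ennreal_mult)
    also have "\<dots> \<le> ennreal (1 / a) * g" using False by (intro mult_left_mono) auto
    finally show "1 \<le> ennreal (1 / a) * g" .
  qed simp
  also have "\<dots> = ennreal (1 / a) * g\<^sup>2" by (simp add: power2_eq_square mult_ac)
  finally show ?thesis by (auto simp: indicator_def add_increasing)
qed

section \<open>Finite correlation at small scales implies absolute continuity\<close>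

definition box_rel :: "'i set \<Rightarrow> real \<Rightarrow> ('i \<Rightarrow> real) \<Rightarrow> ('i \<Rightarrow> real) \<Rightarrow> bool" where
  "box_rel J r u v \<longleftrightarrow> (\<forall>i\<in>J. \<bar>u i - v i\<bar> < r)"

lemma box_rel_triangle: "box_rel J (r / 2) u v \<Longrightarrow> box_rel J (r / 2) u' v \<Longrightarrow> box_rel J r u u'"
  unfolding box_rel_def by (smt (verit) field_sum_of_halves)

lemma measurable_box_rel[measurable]:
  fixes f g :: "'a \<Rightarrow> 'i \<Rightarrow> real"
  assumes J: "finite J" and [measurable]: "f \<in> measurable M (Pi\<^sub>M J (\<lambda>_. lborel))" "g \<in> measurable M (Pi\<^sub>M J (\<lambda>_. lborel))"
  shows "Measurable.pred M (\<lambda>x. box_rel J r (f x) (g x))"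
  unfolding box_rel_def
proof (rule pred_intros_finite(3)[OF J])
  fix i assume i: "i \<in> J"
  have [measurable]: "(\<lambda>x. f x i) \<in> borel_measurable M" "(\<lambda>x. g x i) \<in> borel_measurable M"
    using measurable_compose[OF assms(2) measurable_component_singleton[OF i]]
      measurable_compose[OF assms(3) measurable_component_singleton[OF i]] by simp_all
  show "Measurable.pred M (\<lambda>x. \<bar>f x i - g x i\<bar> < r)" by measurable
qed

lemma nn_integral_box_rel:
  fixes J :: "'i set"
  assumes J: "finite J" and r: "r \<ge> 0" and u: "u \<in> space (Pi\<^sub>M J (\<lambda>_. lborel))"
  shows "(\<integral>\<^sup>+v. indicator {v. box_rel J (r / 2) u v} v \<partial>(Pi\<^sub>M J (\<lambda>_. lborel :: real measure))) = ennreal (r ^ card J)"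
proof -
  interpret product_sigma_finite "\<lambda>_::'i. lborel :: real measure" ..
  interpret finite_product_sigma_finite "\<lambda>_::'i. lborel :: real measure" J by standard fact
  let ?A = "Pi\<^sub>E J (\<lambda>i. {u i - r / 2 <..< u i + r / 2})"
  have "(\<integral>\<^sup>+v. indicator {v. box_rel J (r / 2) u v} v \<partial>(Pi\<^sub>M J (\<lambda>_. lborel :: real measure)))
      = (\<integral>\<^sup>+v. indicator ?A v \<partial>(Pi\<^sub>M J (\<lambda>_. lborel :: real measure)))"
  proof (rule nn_integral_cong)
    fix v :: "'i \<Rightarrow> real" assume "v \<in> space (Pi\<^sub>M J (\<lambda>_. lborel))"
    then have "v \<in> extensional J" by (auto simp: space_PiM PiE_def)
    then have "box_rel J (r / 2) u v \<longleftrightarrow> v \<in> ?A"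
    proof -
      have "\<bar>u i - v i\<bar> < r / 2 \<longleftrightarrow> v i \<in> {u i - r / 2 <..< u i + r / 2}" for i
        by (simp only: greaterThanLessThan_iff) linarith
      then show ?thesis using \<open>v \<in> extensional J\<close> by (simp only: box_rel_def PiE_iff simp_thms)
    qed
    then show "(indicator {v. box_rel J (r / 2) u v} v :: ennreal) = indicator ?A v"
      by (simp add: indicator_def)
  qed
  also have "\<dots> = (\<Prod>i\<in>J. emeasure lborel {u i - r / 2 <..< u i + r / 2})"
    using J by (subst nn_integral_indicator) (auto intro!: sets_PiM_I_finite measure_times)
  also have "\<dots> = ennreal (r ^ card J)"
    using r by (simp add: ennreal_power)
  finally show ?thesis .
qed

locale box_mass =
  fixes J :: "'i::countable set" and \<nu> :: "('i \<Rightarrow> real) measure" and \<rho> :: "nat \<Rightarrow> real"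
  assumes J: "finite J" and nu: "prob_space \<nu>" and sets_nu: "sets \<nu> = sets (Pi\<^sub>M J (\<lambda>_. lborel))"
    and rho_pos: "\<And>n. \<rho> n > 0" and rho_lim: "\<rho> \<longlonglongrightarrow> 0"
begin

abbreviation lam :: "('i \<Rightarrow> real) measure" where "lam \<equiv> Pi\<^sub>M J (\<lambda>_. lborel)"

text \<open>The correlation integral of \<nu> at scale \<open>\<rho> n\<close>, normalised by
  volume; it dominates the squared L2 norm of \<nu> smoothed by cubes of side
  \<open>\<rho> n\<close>.\<close>

definition mass :: "nat \<Rightarrow> ennreal" where
  "mass n = ennreal ((1 / \<rho> n) ^ card J) * (\<integral>\<^sup>+u. \<integral>\<^sup>+u'. indicator {u'. box_rel J (\<rho> n) u u'} u' \<partial>\<nu> \<partial>\<nu>)"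

sublocale nu: prob_space \<nu> by (rule nu)
sublocale product_sigma_finite "\<lambda>_::'i. lborel :: real measure" ..
sublocale finite_product_sigma_finite "\<lambda>_::'i. lborel :: real measure" J by standard (rule J)
sublocale nl: pair_sigma_finite \<nu> lam ..
sublocale ln: pair_sigma_finite lam \<nu> ..

lemmas [measurable_cong] = sets_nu
lemmas [measurable] = measurable_box_rel[OF J]

lemma space_nu: "space \<nu> = space lam"
  by (rule sets_eq_imp_space_eq[OF sets_nu])

definition box_emeasure :: "nat \<Rightarrow> ('i \<Rightarrow> real) \<Rightarrow> ennreal" where
  "box_emeasure n v = (\<integral>\<^sup>+u. indicator {u. box_rel J (\<rho> n / 2) u v} u \<partial>\<nu>)"

lemma measurable_box_emeasure[measurable]: "box_emeasure n \<in> borel_measurable lam"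
  unfolding box_emeasure_def by measurable

lemma rho_power_cancel: "ennreal ((1 / \<rho> n) ^ card J) * ennreal (\<rho> n ^ card J) = 1"
  using rho_pos[of n] by (simp add: ennreal_mult[symmetric] power_one_over)

text \<open>The square is a double integral over u and u'. Both lie within \<rho>/2 of v only if
  they lie within \<rho> of each other, and then v ranges over a set of volume at most \<rho>^|J|,
  which cancels one of the two normalising factors.\<close>

lemma nn_integral_box_emeasure_square_le: "(ennreal ((1 / \<rho> n) ^ card J))\<^sup>2 * (\<integral>\<^sup>+v. (box_emeasure n v)\<^sup>2 \<partial>lam) \<le> mass n"
proof -
  let ?I = "\<lambda>u v. indicator {u. box_rel J (\<rho> n / 2) u v} u :: ennreal"
  have "(\<integral>\<^sup>+v. (box_emeasure n v)\<^sup>2 \<partial>lam) = (\<integral>\<^sup>+v. \<integral>\<^sup>+u. \<integral>\<^sup>+u'. ?I u v * ?I u' v \<partial>\<nu> \<partial>\<nu> \<partial>lam)"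
  proof (rule nn_integral_cong)
    fix v :: "'i \<Rightarrow> real" assume [measurable]: "v \<in> space lam"
    show "(box_emeasure n v)\<^sup>2 = (\<integral>\<^sup>+u. \<integral>\<^sup>+u'. ?I u v * ?I u' v \<partial>\<nu> \<partial>\<nu>)"
      unfolding box_emeasure_def power2_eq_square
      by (simp add: nn_integral_cmult nn_integral_multc)
  qed
  also have "\<dots> = (\<integral>\<^sup>+u. \<integral>\<^sup>+v. \<integral>\<^sup>+u'. ?I u v * ?I u' v \<partial>\<nu> \<partial>lam \<partial>\<nu>)"
    by (rule nl.Fubini') measurable
  also have "\<dots> = (\<integral>\<^sup>+u. \<integral>\<^sup>+u'. \<integral>\<^sup>+v. ?I u v * ?I u' v \<partial>lam \<partial>\<nu> \<partial>\<nu>)"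
  proof (rule nn_integral_cong)
    fix u :: "'i \<Rightarrow> real" assume [measurable]: "u \<in> space \<nu>"
    then have [measurable]: "u \<in> space lam" by (simp add: space_nu)
    show "(\<integral>\<^sup>+v. \<integral>\<^sup>+u'. ?I u v * ?I u' v \<partial>\<nu> \<partial>lam) = (\<integral>\<^sup>+u'. \<integral>\<^sup>+v. ?I u v * ?I u' v \<partial>lam \<partial>\<nu>)"
      by (rule nl.Fubini') measurable
  qed
  also have "\<dots> \<le> (\<integral>\<^sup>+u. \<integral>\<^sup>+u'. ennreal (\<rho> n ^ card J) * indicator {u'. box_rel J (\<rho> n) u u'} u' \<partial>\<nu> \<partial>\<nu>)"
  proof (intro nn_integral_mono)
    fix u u' :: "'i \<Rightarrow> real" assume uu: "u \<in> space \<nu>" "u' \<in> space \<nu>"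
    then have [measurable]: "u \<in> space lam" by (simp add: space_nu)
    have "(\<integral>\<^sup>+v. ?I u v * ?I u' v \<partial>lam)
       \<le> (\<integral>\<^sup>+v. indicator {u'. box_rel J (\<rho> n) u u'} u' * indicator {v. box_rel J (\<rho> n / 2) u v} v \<partial>lam)"
      by (intro nn_integral_mono) (auto simp: indicator_def intro: box_rel_triangle)
    also have "\<dots> = indicator {u'. box_rel J (\<rho> n) u u'} u' * ennreal (\<rho> n ^ card J)"
      using nn_integral_box_rel[OF J, of "\<rho> n" u] rho_pos[of n] uu
      by (simp add: nn_integral_cmult space_nu less_imp_le)
    finally show "(\<integral>\<^sup>+v. ?I u v * ?I u' v \<partial>lam) \<le> ennreal (\<rho> n ^ card J) * indicator {u'. box_rel J (\<rho> n) u u'} u'"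
      by (simp add: mult.commute)
  qed
  also have "\<dots> = ennreal (\<rho> n ^ card J) * (\<integral>\<^sup>+u. \<integral>\<^sup>+u'. indicator {u'. box_rel J (\<rho> n) u u'} u' \<partial>\<nu> \<partial>\<nu>)"
  proof -
    have "(\<integral>\<^sup>+u'. ennreal (\<rho> n ^ card J) * indicator {u'. box_rel J (\<rho> n) u u'} u' \<partial>\<nu>)
      = ennreal (\<rho> n ^ card J) * (\<integral>\<^sup>+u'. indicator {u'. box_rel J (\<rho> n) u u'} u' \<partial>\<nu>)" if "u \<in> space \<nu>" for u
    proof -
      from that have [measurable]: "u \<in> space lam" by (simp add: space_nu)
      show ?thesis by (rule nn_integral_cmult) measurable
    qed
    then show ?thesis by (simp add: nn_integral_cmult cong: nn_integral_cong)
  qed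
  finally have "(ennreal ((1 / \<rho> n) ^ card J))\<^sup>2 * (\<integral>\<^sup>+v. (box_emeasure n v)\<^sup>2 \<partial>lam)
     \<le> (ennreal ((1 / \<rho> n) ^ card J))\<^sup>2 * (ennreal (\<rho> n ^ card J) * (\<integral>\<^sup>+u. \<integral>\<^sup>+u'. indicator {u'. box_rel J (\<rho> n) u u'} u' \<partial>\<nu> \<partial>\<nu>))"
    by (intro mult_left_mono) auto
  also have "\<dots> = (ennreal ((1 / \<rho> n) ^ card J) * ennreal (\<rho> n ^ card J)) * mass n"
    unfolding mass_def power2_eq_square by (simp only: mult_ac)
  finally show ?thesis by (simp only: rho_power_cancel mult_1)
qed

text \<open>By Fubini the left side is the integral over U of the smoothed density of \<nu>, to
  which the pointwise inequality with weight a applies.\<close>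

lemma nn_integral_box_average_le:
  assumes [measurable]: "U \<in> sets lam" and a: "a > 0"
  shows "(\<integral>\<^sup>+u. ennreal ((1 / \<rho> n) ^ card J) * (\<integral>\<^sup>+v. indicator U v * indicator {v. box_rel J (\<rho> n / 2) u v} v \<partial>lam) \<partial>\<nu>)
     \<le> ennreal a * emeasure lam U + ennreal (1 / a) * mass n"
proof -
  let ?c = "ennreal ((1 / \<rho> n) ^ card J)"
  have "(\<integral>\<^sup>+u. ?c * (\<integral>\<^sup>+v. indicator U v * indicator {v. box_rel J (\<rho> n / 2) u v} v \<partial>lam) \<partial>\<nu>)
     = ?c * (\<integral>\<^sup>+u. \<integral>\<^sup>+v. indicator U v * indicator {v. box_rel J (\<rho> n / 2) u v} v \<partial>lam \<partial>\<nu>)"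
    by (rule nn_integral_cmult) measurable
  also have "(\<integral>\<^sup>+u. \<integral>\<^sup>+v. indicator U v * indicator {v. box_rel J (\<rho> n / 2) u v} v \<partial>lam \<partial>\<nu>)
     = (\<integral>\<^sup>+v. \<integral>\<^sup>+u. indicator U v * indicator {v. box_rel J (\<rho> n / 2) u v} v \<partial>\<nu> \<partial>lam)"
    by (rule ln.Fubini') measurable
  also have "\<dots> = (\<integral>\<^sup>+v. indicator U v * box_emeasure n v \<partial>lam)"
  proof (rule nn_integral_cong)
    fix v :: "'i \<Rightarrow> real" assume [measurable]: "v \<in> space lam"
    have "(\<integral>\<^sup>+u. indicator U v * indicator {v. box_rel J (\<rho> n / 2) u v} v \<partial>\<nu>)
      = (\<integral>\<^sup>+u. indicator U v * indicator {u. box_rel J (\<rho> n / 2) u v} u \<partial>\<nu>)"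
      by (simp add: indicator_def)
    also have "\<dots> = indicator U v * box_emeasure n v"
      unfolding box_emeasure_def by (rule nn_integral_cmult) measurable
    finally show "(\<integral>\<^sup>+u. indicator U v * indicator {v. box_rel J (\<rho> n / 2) u v} v \<partial>\<nu>) = indicator U v * box_emeasure n v" .
  qed
  also have "?c * \<dots> = (\<integral>\<^sup>+v. (?c * box_emeasure n v) * indicator U v \<partial>lam)"
    by (subst nn_integral_cmult[symmetric]) (auto simp: mult_ac)
  also have "\<dots> \<le> (\<integral>\<^sup>+v. ennreal a * indicator U v + ennreal (1 / a) * (?c * box_emeasure n v)\<^sup>2 \<partial>lam)"
    by (intro nn_integral_mono ennreal_mult_indicator_le a)
  also have "\<dots> = ennreal a * emeasure lam U + ennreal (1 / a) * (?c\<^sup>2 * (\<integral>\<^sup>+v. (box_emeasure n v)\<^sup>2 \<partial>lam))"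
    by (simp add: nn_integral_add nn_integral_cmult power_mult_distrib nn_integral_cmult_indicator)
  also have "\<dots> \<le> ennreal a * emeasure lam U + ennreal (1 / a) * mass n"
    by (intro add_left_mono mult_left_mono nn_integral_box_emeasure_square_le) auto
  finally show ?thesis .
qed

text \<open>The normalised averages of the indicator of \<open>U\<close> over small boxes tend to \<open>1\<close> on \<open>U\<close>, so Fatou's
  lemma applies.\<close>

lemma emeasure_box_open_le:
  assumes U: "U \<in> sets lam" and a: "a > 0" and T: "liminf mass < ennreal T"
    and bo: "\<And>u. u \<in> U \<Longrightarrow> \<exists>\<delta>>0. \<forall>v\<in>space lam. box_rel J \<delta> u v \<longrightarrow> v \<in> U"
  shows "emeasure \<nu> U \<le> ennreal a * emeasure lam U + ennreal (1 / a) * ennreal T"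
proof -
  note U[measurable]
  define F where "F n u = ennreal ((1 / \<rho> n) ^ card J) * (\<integral>\<^sup>+v. indicator U v * indicator {v. box_rel J (\<rho> n / 2) u v} v \<partial>lam)" for n u
  have [measurable]: "F n \<in> borel_measurable \<nu>" for n
    unfolding F_def by measurable
  have lim: "indicator U u \<le> liminf (\<lambda>n. F n u)" if u: "u \<in> space \<nu>" for u
  proof (cases "u \<in> U")
    case True
    obtain \<delta> where \<delta>: "\<delta> > 0" "\<And>v. v \<in> space lam \<Longrightarrow> box_rel J \<delta> u v \<Longrightarrow> v \<in> U" using bo[OF True] by auto
    have "eventually (\<lambda>n. \<rho> n < \<delta>) sequentially"
      using order_tendstoD(2)[OF rho_lim \<delta>(1)] .
    then have "eventually (\<lambda>n. 1 \<le> F n u) sequentially"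
    proof eventually_elim
      fix n assume n: "\<rho> n < \<delta>"
      have "(\<integral>\<^sup>+v. indicator U v * indicator {v. box_rel J (\<rho> n / 2) u v} v \<partial>lam)
          = (\<integral>\<^sup>+v. indicator {v. box_rel J (\<rho> n / 2) u v} v \<partial>lam)"
      proof (rule nn_integral_cong)
        fix v assume v: "v \<in> space lam"
        have "v \<in> U" if "box_rel J (\<rho> n / 2) u v"
          using that n rho_pos[of n] by (intro \<delta>(2)[OF v]) (force simp: box_rel_def)
        then show "indicator U v * indicator {v. box_rel J (\<rho> n / 2) u v} v = (indicator {v. box_rel J (\<rho> n / 2) u v} v :: ennreal)"
          by (auto simp: indicator_def)
      qed
      also have "\<dots> = ennreal (\<rho> n ^ card J)"
        using u rho_pos[of n] by (intro nn_integral_box_rel J) (auto simp: space_nu)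
      finally show "1 \<le> F n u" unfolding F_def by (simp only: rho_power_cancel order_refl)
    qed
    then show ?thesis using True by (simp add: Liminf_bounded)
  qed simp
  have "emeasure \<nu> U = (\<integral>\<^sup>+u. indicator U u \<partial>\<nu>)"
    using U by (simp add: sets_nu)
  also have "\<dots> \<le> (\<integral>\<^sup>+u. liminf (\<lambda>n. F n u) \<partial>\<nu>)"
    by (intro nn_integral_mono lim)
  also have "\<dots> \<le> liminf (\<lambda>n. \<integral>\<^sup>+u. F n u \<partial>\<nu>)"
    by (rule nn_integral_liminf) measurable
  also have "\<dots> \<le> ennreal a * emeasure lam U + ennreal (1 / a) * ennreal T"
  proof (rule ccontr)
    \<comment> \<open>Only the lower limit of \<open>mass\<close> is controlled, not the whole
      sequence. If the bound failed, the averages would eventually exceed it, forcing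
      \<open>mass n\<close> to be eventually at least T, against the choice of T.\<close>
    assume "\<not> ?thesis"
    then have "eventually (\<lambda>n. ennreal a * emeasure lam U + ennreal (1 / a) * ennreal T < (\<integral>\<^sup>+u. F n u \<partial>\<nu>)) sequentially"
      by (intro less_LiminfD) (simp add: not_le)
    then have "eventually (\<lambda>n. ennreal T \<le> mass n) sequentially"
    proof eventually_elim
      fix n assume "ennreal a * emeasure lam U + ennreal (1 / a) * ennreal T < (\<integral>\<^sup>+u. F n u \<partial>\<nu>)"
      also have "\<dots> \<le> ennreal a * emeasure lam U + ennreal (1 / a) * mass n"
        unfolding F_def by (rule nn_integral_box_average_le[OF U a])
      finally show "ennreal T \<le> mass n"
        by (meson add_left_mono leD linear mult_left_mono zero_le)
    qed
    then have "ennreal T \<le> liminf mass" by (rule Liminf_bounded)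
    with T show False by simp
  qed
  finally show ?thesis .
qed

text \<open>Cover a null set by an open set of tiny volume and apply the previous estimate with a
  large weight a: both terms become small.\<close>

lemma absolutely_continuous:
  assumes T: "liminf mass < \<infinity>"
  shows "absolutely_continuous lam \<nu>"
  unfolding absolutely_continuous_def
proof
  fix N assume N: "N \<in> null_sets lam"
  then have N_sets[measurable]: "N \<in> sets lam" by auto
  obtain t where t: "t \<ge> 0" "liminf mass = ennreal t"
    using T by (cases "liminf mass") auto
  define T' where "T' = t + 1"
  have T': "T' \<ge> 0" "liminf mass < ennreal T'"
    using t by (auto simp: T'_def ennreal_less_iff simp del: ennreal_plus)
  have sp: "space lam = extensional J" by (auto simp: space_PiM PiE_def)
  \<comment> \<open>Cutting down to a cube makes Lebesgue measure finite, as outer regularity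
    requires.\<close>
  have "emeasure \<nu> (N \<inter> {u\<in>space lam. box_rel J (real R) (\<lambda>i\<in>J. 0) u}) = 0" (is "emeasure \<nu> (N \<inter> ?B) = 0") for R :: nat
  proof -
    have z[measurable]: "(\<lambda>i\<in>J. 0) \<in> space lam" by (simp add: sp)
    have B[measurable]: "?B \<in> sets lam" by measurable
    have id[measurable]: "(\<lambda>u. u) \<in> measurable lam (borel :: ('i \<Rightarrow> real) measure)"
      by (rule measurable_PiM_borel) simp
    have re[measurable]: "(\<lambda>u. restrict u J) \<in> measurable (borel :: ('i \<Rightarrow> real) measure) lam"
      by (intro measurable_restrict) (auto intro: borel_measurable_continuous_onI)
    define M where "M = distr (density lam (indicator ?B)) (borel :: ('i \<Rightarrow> real) measure) (\<lambda>u. u)"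
    have M: "emeasure M A = emeasure lam (A \<inter> ?B)" if A: "A \<in> sets borel" for A
    proof -
      have "(\<lambda>u. u) -` A \<inter> space lam \<in> sets lam" using id A by (rule measurable_sets)
      then have A': "A \<inter> space lam \<in> sets lam" by simp
      have "emeasure M A = emeasure (density lam (indicator ?B)) (A \<inter> space lam)"
        unfolding M_def using A by (subst emeasure_distr) auto
      also have "\<dots> = (\<integral>\<^sup>+u. indicator ?B u * indicator (A \<inter> space lam) u \<partial>lam)"
        using A' by (intro emeasure_density) auto
      also have "\<dots> = (\<integral>\<^sup>+u. indicator (?B \<inter> (A \<inter> space lam)) u \<partial>lam)"
        by (simp only: indicator_inter_arith)
      also have "\<dots> = emeasure lam (?B \<inter> (A \<inter> space lam))"
        using A' by (intro nn_integral_indicator) auto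
      also have "?B \<inter> (A \<inter> space lam) = A \<inter> ?B" by auto
      finally show ?thesis .
    qed
    have fin: "emeasure M (space M) \<noteq> \<infinity>"
    proof -
      have "emeasure M (space M) = emeasure lam ?B"
        using M[of UNIV] by (simp add: M_def)
      also have "\<dots> = (\<integral>\<^sup>+v. indicator ?B v \<partial>lam)"
        by (rule nn_integral_indicator[symmetric, OF B])
      also have "\<dots> = (\<integral>\<^sup>+v. indicator {v. box_rel J (2 * real R / 2) (\<lambda>i\<in>J. 0) v} v \<partial>lam)"
        by (intro nn_integral_cong) (auto simp: indicator_def)
      also have "\<dots> < \<infinity>"
        by (subst nn_integral_box_rel[OF J _ z]) auto
      finally show ?thesis by simp
    qed
    \<comment> \<open>Outer regularity lives on the full function space, so N is replaced by its
      preimage under restriction, which is Borel there and agrees with N on extensional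
      functions.\<close>
    define N' where "N' = (\<lambda>u. restrict u J) -` N"
    have N': "N' \<in> sets borel"
      using measurable_sets[OF re N_sets] by (simp add: N'_def)
    have "emeasure M N' = emeasure lam (N \<inter> ?B)"
    proof -
      have "N' \<inter> ?B = N \<inter> ?B" by (auto simp: N'_def sp extensional_restrict)
      then show ?thesis using M[OF N'] by simp
    qed
    also have "\<dots> = 0" using N B by (metis null_setsD1 null_set_Int2 Int_commute)
    finally have M0: "emeasure M N' = 0" .
    have le: "emeasure \<nu> (N \<inter> ?B) \<le> ennreal ((1 + T') / real (Suc n))" for n
    proof -
      \<comment> \<open>Weight a and volume below 1/a^2 balance the two terms: each is
        O(1/a).\<close>
      let ?a = "real (Suc n)"
      have "(INF U \<in> {U. N' \<subseteq> U \<and> open U}. emeasure M U) < ennreal (1 / ?a\<^sup>2)"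
        unfolding outer_regular[OF _ fin N', symmetric, unfolded M_def sets_distr, OF refl, folded M_def] M0
        by simp
      then obtain U where U: "N' \<subseteq> U" "open U" "emeasure M U < ennreal (1 / ?a\<^sup>2)"
        by (auto simp: INF_less_iff)
      have "(\<lambda>u. u) -` U \<inter> space lam \<in> sets lam" by (rule measurable_sets[OF id]) (use U(2) in simp)
      then have Us: "U \<inter> space lam \<in> sets lam" by simp
      have UB: "U \<inter> ?B \<in> sets lam"
      proof -
        have "U \<inter> ?B = (U \<inter> space lam) \<inter> ?B" by auto
        then show ?thesis using Us B by auto
      qed
      have "N \<inter> ?B \<subseteq> U \<inter> ?B"
        using U(1) by (auto simp: N'_def sp extensional_restrict)
      then have "emeasure \<nu> (N \<inter> ?B) \<le> emeasure \<nu> (U \<inter> ?B)"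
        using UB by (intro emeasure_mono) (auto simp: sets_nu)
      also have "\<dots> \<le> ennreal ?a * emeasure lam (U \<inter> ?B) + ennreal (1 / ?a) * ennreal T'"
      proof (rule emeasure_box_open_le[OF UB _ T'(2)])
        fix u assume u: "u \<in> U \<inter> ?B"
        \<comment> \<open>Intersecting with the open cube ensures that a small box around u stays in
          \<open>?B\<close> as well as in U.\<close>
        define W where "W = U \<inter> {u. \<forall>i\<in>J. \<bar>u i\<bar> < real R}"
        have "open {u :: 'i \<Rightarrow> real. \<bar>u i\<bar> < real R}" for i
          by (intro open_Collect_less continuous_intros continuous_on_product_coordinates)
        then have "open W" unfolding W_def using J U(2)
          by (auto intro!: open_Int simp: Collect_ball_eq)
        moreover have "u \<in> W" using u by (auto simp: W_def box_rel_def)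
        moreover have "u \<in> extensional J" using u by (auto simp: sp)
        ultimately obtain \<delta> where "\<delta> > 0" "\<And>v. v \<in> extensional J \<Longrightarrow> (\<And>i. i \<in> J \<Longrightarrow> \<bar>u i - v i\<bar> < \<delta>) \<Longrightarrow> v \<in> W"
          using open_fun_contains_box[OF _ _ J] by blast
        then show "\<exists>\<delta>>0. \<forall>v\<in>space lam. box_rel J \<delta> u v \<longrightarrow> v \<in> U \<inter> ?B"
          by (intro exI[of _ \<delta>]) (auto simp: sp box_rel_def W_def)
      qed simp
      also have "emeasure lam (U \<inter> ?B) = emeasure M U"
        using U(2) by (simp add: M)
      also have "ennreal ?a * emeasure M U + ennreal (1 / ?a) * ennreal T' \<le> ennreal ?a * ennreal (1 / ?a\<^sup>2) + ennreal (1 / ?a) * ennreal T'"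
        using U(3) by (intro add_right_mono mult_left_mono) auto
      also have "\<dots> = ennreal ((1 + T') / ?a)"
        using T'(1) by (simp add: ennreal_mult[symmetric] ennreal_plus[symmetric] power2_eq_square add_divide_distrib
            del: ennreal_plus of_nat_Suc)
      finally show ?thesis .
    qed
    have "(\<lambda>n. ennreal ((1 + T') / real (Suc n))) \<longlonglongrightarrow> ennreal 0"
      by (intro tendsto_ennrealI LIMSEQ_Suc lim_const_over_n)
    from LIMSEQ_le_const[OF this, of "emeasure \<nu> (N \<inter> ?B)"] le
    show ?thesis by auto
  qed
  then have "(\<Union>R. N \<inter> {u\<in>space lam. box_rel J (real R) (\<lambda>i\<in>J. 0) u}) \<in> null_sets \<nu>"
  proof (intro null_sets_UN' null_setsI)
    fix R :: nat
    have z[measurable]: "(\<lambda>i\<in>J. 0) \<in> space lam" by (simp add: sp)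
    show "N \<inter> {u\<in>space lam. box_rel J (real R) (\<lambda>i\<in>J. 0) u} \<in> sets \<nu>"
      unfolding sets_nu by measurable
  qed auto
  also have "(\<Union>R. N \<inter> {u\<in>space lam. box_rel J (real R) (\<lambda>i\<in>J. 0) u}) = N"
  proof safe
    fix u assume u: "u \<in> N"
    obtain R :: nat where R: "Max (insert 0 ((\<lambda>i. \<bar>u i\<bar>) ` J)) < real R" using reals_Archimedean2 by blast
    have "u \<in> space lam" using sets.sets_into_space[OF N_sets] u by auto
    moreover have "box_rel J (real R) (\<lambda>i\<in>J. 0) u"
      using R J by (auto simp: box_rel_def)
    ultimately show "u \<in> (\<Union>R. N \<inter> {u\<in>space lam. box_rel J (real R) (\<lambda>i\<in>J. 0) u})"
      using u by auto
  qed
  finally show "N \<in> null_sets \<nu>" .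
qed

end

subsection \<open>Absolute continuity of distance maps\<close>

text \<open>The interface between the two halves of the proof: the argument on distances uses
  Fourier decay only through these slab and energy bounds.\<close>

locale slab_measure =
  fixes \<mu> :: "'a::euclidean_space measure" and E :: "'a set" and K :: real and k :: nat
  assumes mu: "prob_space \<mu>" and sets_mu: "sets \<mu> = sets borel"
    and compact_E: "compact E" and AE_E: "AE y in \<mu>. y \<in> E"
    and K_nonneg: "K \<ge> 0"
    and slab: "\<And>w c \<rho>. w \<noteq> 0 \<Longrightarrow> \<rho> > 0 \<Longrightarrow> emeasure \<mu> {y. \<bar>y \<bullet> w - c\<bar> \<le> \<rho>} \<le> ennreal (K * \<rho> / norm w)"
    and energy: "\<And>j. j \<le> k \<Longrightarrow> (\<integral>\<^sup>+p. ennreal (1 / norm (fst p - snd p) ^ j) \<partial>(\<mu> \<Otimes>\<^sub>M \<mu>)) < \<infinity>"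
    and AE_neq: "AE p in \<mu> \<Otimes>\<^sub>M \<mu>. fst p \<noteq> snd p"
begin

sublocale mu: prob_space \<mu> by (rule mu)
sublocale mu2: pair_prob_space \<mu> \<mu> ..
sublocale product_prob_space "\<lambda>_::nat. \<mu>" ..

lemmas [measurable_cong] = sets_mu

lemma space_mu: "space \<mu> = UNIV"
  using sets_eq_imp_space_eq[OF sets_mu] by simp

lemma prob_space_power: "prob_space (measure_power j \<mu>)"
  unfolding measure_power_def by (intro prob_space_PiM mu)

end

section \<open>The new distances contributed by one additional point\<close>

definition dist_layer :: "nat \<Rightarrow> (nat \<times> nat) set" where
  "dist_layer m = (\<lambda>a. (a, Suc m)) ` {..m}"

lemma finite_dist_layer [simp]: "finite (dist_layer m)"
  by (simp add: dist_layer_def)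

lemma card_dist_layer: "card (dist_layer m) = Suc m"
  by (simp add: dist_layer_def card_image inj_on_def)

lemma dist_pairs_Suc: "dist_pairs (Suc m) = dist_pairs m \<union> dist_layer m"
  by (auto simp: dist_pairs_def dist_layer_def)

lemma dist_pairs_layer_disjoint: "dist_pairs m \<inter> dist_layer m = {}"
  by (auto simp: dist_pairs_def dist_layer_def)

text \<open>The distance \<open>s\<close> is recorded as \<open>h s\<close>; the two choices \<open>h s = s\<^sup>2\<close> and \<open>h s = s\<close> give the
  two conclusions of the theorem.\<close>

locale slab_measure_gauge = slab_measure \<mu> E K k
  for \<mu> :: "'a::euclidean_space measure" and E K k +
  fixes h :: "real \<Rightarrow> real" and M :: real
  assumes h_measurable[measurable]: "h \<in> borel_measurable borel"
    and M_pos: "M > 0"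
    and h_square: "\<And>x y y'. x \<in> E \<Longrightarrow> y \<in> E \<Longrightarrow> y' \<in> E \<Longrightarrow>
      \<bar>(norm (x - y))\<^sup>2 - (norm (x - y'))\<^sup>2\<bar> \<le> M * \<bar>h (norm (x - y)) - h (norm (x - y'))\<bar>"
begin

definition layer :: "nat \<Rightarrow> (nat \<Rightarrow> 'a) \<Rightarrow> 'a \<Rightarrow> (nat \<times> nat \<Rightarrow> real)" where
  "layer m z y = (\<lambda>(a, b)\<in>dist_layer m. h (norm (z a - y)))"

lemma measurable_layer[measurable]: "layer m z \<in> measurable \<mu> (Pi\<^sub>M (dist_layer m) (\<lambda>_. lborel))"
  unfolding layer_def by (rule measurable_restrict) (auto split: prod.split)

definition layer_measure :: "nat \<Rightarrow> (nat \<Rightarrow> 'a) \<Rightarrow> (nat \<times> nat \<Rightarrow> real) measure" where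
  "layer_measure m z = distr \<mu> (Pi\<^sub>M (dist_layer m) (\<lambda>_. lborel)) (layer m z)"

definition close :: "nat \<Rightarrow> real \<Rightarrow> (nat \<Rightarrow> 'a) \<Rightarrow> 'a \<Rightarrow> 'a \<Rightarrow> bool" where
  "close m r z y y' \<longleftrightarrow> (\<forall>a\<in>{..m}. \<bar>h (norm (z a - y)) - h (norm (z a - y'))\<bar> < r)"

lemma box_rel_layer: "box_rel (dist_layer m) r (layer m z y) (layer m z y') \<longleftrightarrow> close m r z y y'"
  by (auto simp: box_rel_def layer_def close_def dist_layer_def)

lemma measurable_close[measurable]:
  assumes [measurable]: "f \<in> measurable N (Pi\<^sub>M {..m} (\<lambda>_. \<mu>))" "g \<in> borel_measurable N" "g' \<in> borel_measurable N"
  shows "Measurable.pred N (\<lambda>x. close m r (f x) (g x) (g' x))"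
  unfolding close_def
proof (rule pred_intros_finite(3))
  fix a assume a: "a \<in> {..m}"
  have "(\<lambda>x. f x a) \<in> measurable N \<mu>"
    by (rule measurable_compose[OF assms(1) measurable_component_singleton[OF a]])
  then have [measurable]: "(\<lambda>x. f x a) \<in> borel_measurable N"
    using sets_mu measurable_cong_sets by blast
  show "Measurable.pred N (\<lambda>x. \<bar>h (norm (f x a - g x)) - h (norm (f x a - g' x))\<bar> < r)" by measurable
qed simp

definition \<rho> :: "nat \<Rightarrow> real" where "\<rho> n = 1 / real (Suc n)"

lemma rho_pos: "\<rho> n > 0" by (simp add: \<rho>_def)

lemma rho_lim: "\<rho> \<longlonglongrightarrow> 0"
  unfolding \<rho>_def by (rule LIMSEQ_Suc[OF lim_1_over_n])

text \<open>The correlation integral of \<open>layer_measure m z\<close>, written over \<mu> so that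
  it is visibly measurable in the base tuple z, over which it will be averaged.\<close>

definition mass :: "nat \<Rightarrow> (nat \<Rightarrow> 'a) \<Rightarrow> nat \<Rightarrow> ennreal" where
  "mass m z n = ennreal ((1 / \<rho> n) ^ Suc m) *
     (\<integral>\<^sup>+y. \<integral>\<^sup>+y'. indicator {z. close m (\<rho> n) z y y'} z \<partial>\<mu> \<partial>\<mu>)"

lemma measurable_mass[measurable]: "(\<lambda>z. mass m z n) \<in> borel_measurable (Pi\<^sub>M {..m} (\<lambda>_. \<mu>))"
  unfolding mass_def by measurable

lemma layer_absolutely_continuous:
  assumes "liminf (mass m z) < \<infinity>"
  shows "absolutely_continuous (Pi\<^sub>M (dist_layer m) (\<lambda>_. lborel)) (layer_measure m z)"
proof -
  let ?L = "Pi\<^sub>M (dist_layer m) (\<lambda>_. lborel :: real measure)"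
  have "box_mass (dist_layer m) (layer_measure m z) \<rho>"
  proof (rule box_mass.intro)
    show "prob_space (layer_measure m z)"
      unfolding layer_measure_def by (rule mu.prob_space_distr[OF measurable_layer])
  qed (simp_all add: rho_pos rho_lim layer_measure_def)
  then interpret B: box_mass "dist_layer m" "layer_measure m z" \<rho> .
  have "B.mass n = mass m z n" for n
  proof -
    let ?I = "\<lambda>u u'. indicator {u'. box_rel (dist_layer m) (\<rho> n) u u'} u' :: ennreal"
    have I: "?I u \<in> borel_measurable ?L" if u[measurable]: "u \<in> space ?L" for u
      by measurable
    have "(\<lambda>p. ?I (fst p) (snd p)) \<in> borel_measurable (?L \<Otimes>\<^sub>M ?L)"
      by measurable
    then have F: "(\<lambda>u. \<integral>\<^sup>+u'. ?I u u' \<partial>layer_measure m z) \<in> borel_measurable ?L"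
      using B.nu.borel_measurable_nn_integral_fst[of "\<lambda>p. ?I (fst p) (snd p)" ?L]
        measurable_cong_sets[OF sets_pair_measure_cong[OF refl B.sets_nu, of ?L] refl] by simp
    have "(\<integral>\<^sup>+u. F u \<partial>layer_measure m z) = (\<integral>\<^sup>+y. F (layer m z y) \<partial>\<mu>)"
      if "F \<in> borel_measurable ?L" for F
      unfolding layer_measure_def by (rule nn_integral_distr[OF measurable_layer]) (simp add: that)
    note distr = this
    from distr[OF F]
    have "(\<integral>\<^sup>+u. \<integral>\<^sup>+u'. ?I u u' \<partial>layer_measure m z \<partial>layer_measure m z)
       = (\<integral>\<^sup>+y. \<integral>\<^sup>+u'. ?I (layer m z y) u' \<partial>layer_measure m z \<partial>\<mu>)" .
    also have "\<dots> = (\<integral>\<^sup>+y. \<integral>\<^sup>+y'. ?I (layer m z y) (layer m z y') \<partial>\<mu> \<partial>\<mu>)"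
    proof (rule nn_integral_cong)
      fix y assume "y \<in> space \<mu>"
      from distr[OF I[OF measurable_space[OF measurable_layer this]]]
      show "(\<integral>\<^sup>+u'. ?I (layer m z y) u' \<partial>layer_measure m z) = (\<integral>\<^sup>+y'. ?I (layer m z y) (layer m z y') \<partial>\<mu>)" .
    qed
    also have "\<dots> = (\<integral>\<^sup>+y. \<integral>\<^sup>+y'. indicator {z. close m (\<rho> n) z y y'} z \<partial>\<mu> \<partial>\<mu>)"
      by (simp only: indicator_def mem_Collect_eq box_rel_layer)
    finally show ?thesis
      unfolding B.mass_def mass_def card_dist_layer by (simp only:)
  qed
  then have "B.mass = mass m z" by (rule ext)
  with assms show ?thesis by (intro B.absolutely_continuous) simp
qed

text \<open>The conditions on the single base points are independent under the product measure, and
  each confines its point to a slab orthogonal to y - y'. Hence the power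
  \<open>Suc m\<close>.\<close>

lemma nn_integral_close_le:
  assumes y: "y \<in> E" "y' \<in> E" "y \<noteq> y'" and r: "r > 0"
  shows "(\<integral>\<^sup>+z. indicator {z. close m r z y y'} z \<partial>(Pi\<^sub>M {..m} (\<lambda>_. \<mu>)))
    \<le> ennreal ((K * M / 2 * r) ^ Suc m) * ennreal (1 / norm (y - y') ^ Suc m)"
proof -
  define q :: "'a \<Rightarrow> ennreal" where
    "q \<zeta> = indicator {\<zeta>. \<bar>h (norm (\<zeta> - y)) - h (norm (\<zeta> - y'))\<bar> < r} \<zeta>" for \<zeta>
  have [measurable]: "q \<in> borel_measurable \<mu>" unfolding q_def by measurable
  have "(\<integral>\<^sup>+z. indicator {z. close m r z y y'} z \<partial>(Pi\<^sub>M {..m} (\<lambda>_. \<mu>)))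
     = (\<integral>\<^sup>+z. (\<Prod>a\<in>{..m}. q (z a)) \<partial>(Pi\<^sub>M {..m} (\<lambda>_. \<mu>)))"
    by (intro nn_integral_cong) (auto simp: q_def close_def indicator_def)
  also have "\<dots> = (\<Prod>a\<in>{..m}. \<integral>\<^sup>+\<zeta>. q \<zeta> \<partial>\<mu>)"
    by (rule product_nn_integral_prod) auto
  also have "\<dots> = (\<integral>\<^sup>+\<zeta>. q \<zeta> \<partial>\<mu>) ^ Suc m" by simp
  also have "\<dots> \<le> ennreal (K * (M * r / 2) / norm (y - y')) ^ Suc m"
  proof (rule power_mono)
    \<comment> \<open>The hyperplane with this offset is the perpendicular bisector of y and y'; the
      difference of squared distances is -2 times the deviation from it, whence the half-width M r /
      2.\<close>
    let ?c = "((norm y)\<^sup>2 - (norm y')\<^sup>2) / 2"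
    let ?S = "{\<zeta>. \<bar>\<zeta> \<bullet> (y - y') - ?c\<bar> \<le> M * r / 2}"
    have S: "?S \<in> sets \<mu>" unfolding sets_mu by measurable
    have "(\<integral>\<^sup>+\<zeta>. q \<zeta> \<partial>\<mu>) \<le> (\<integral>\<^sup>+\<zeta>. indicator ?S \<zeta> \<partial>\<mu>)"
    proof (rule nn_integral_mono_AE, use AE_E in eventually_elim)
      fix \<zeta> assume "\<zeta> \<in> E"
      have "\<zeta> \<in> ?S" if "\<bar>h (norm (\<zeta> - y)) - h (norm (\<zeta> - y'))\<bar> < r"
      proof -
        have "M * \<bar>h (norm (\<zeta> - y)) - h (norm (\<zeta> - y'))\<bar> \<le> M * r"
          using that M_pos by (intro mult_left_mono) auto
        then have "\<bar>(norm (\<zeta> - y))\<^sup>2 - (norm (\<zeta> - y'))\<^sup>2\<bar> \<le> M * r"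
          using h_square[OF \<open>\<zeta> \<in> E\<close> y(1,2)] by linarith
        moreover have "(norm (\<zeta> - y))\<^sup>2 - (norm (\<zeta> - y'))\<^sup>2 = - 2 * (\<zeta> \<bullet> (y - y') - ?c)"
          by (simp add: power2_norm_eq_inner inner_diff_left inner_diff_right inner_commute field_simps)
        ultimately have "\<bar>- 2 * (\<zeta> \<bullet> (y - y') - ?c)\<bar> \<le> M * r" by (simp only:)
        moreover have "\<bar>- 2 * t\<bar> = 2 * \<bar>t\<bar>" for t :: real by simp
        ultimately have "2 * \<bar>\<zeta> \<bullet> (y - y') - ?c\<bar> \<le> M * r" by (simp only:)
        then show ?thesis by simp
      qed
      then show "q \<zeta> \<le> indicator ?S \<zeta>" by (auto simp: q_def indicator_def)
    qed
    also have "\<dots> = emeasure \<mu> ?S" using S by simp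
    also have "\<dots> \<le> ennreal (K * (M * r / 2) / norm (y - y'))"
      using y r M_pos by (intro slab) auto
    finally show "(\<integral>\<^sup>+\<zeta>. q \<zeta> \<partial>\<mu>) \<le> ennreal (K * (M * r / 2) / norm (y - y'))" .
  qed simp
  also have "\<dots> = ennreal ((K * M / 2 * r) ^ Suc m) * ennreal (1 / norm (y - y') ^ Suc m)"
    using K_nonneg M_pos r
    by (simp add: ennreal_power ennreal_mult[symmetric] power_divide power_mult_distrib mult_ac del: power_Suc)
  finally show ?thesis .
qed

text \<open>Integrating over the base tuple before the pair yields a power of the scale that cancels
  the normalisation, so the bound is uniform in n.\<close>

lemma nn_integral_mass_le:
  "(\<integral>\<^sup>+z. mass m z n \<partial>(Pi\<^sub>M {..m} (\<lambda>_. \<mu>)))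
     \<le> ennreal ((K * M / 2) ^ Suc m) * (\<integral>\<^sup>+p. ennreal (1 / norm (fst p - snd p) ^ Suc m) \<partial>(\<mu> \<Otimes>\<^sub>M \<mu>))"
proof -
  interpret F: finite_product_sigma_finite "\<lambda>_::nat. \<mu>" "{..m}" by standard simp
  let ?P = "Pi\<^sub>M {..m} (\<lambda>_. \<mu>)"
  let ?c = "ennreal ((1 / \<rho> n) ^ Suc m)"
  interpret B: pair_sigma_finite "\<mu> \<Otimes>\<^sub>M \<mu>" ?P ..
  let ?I = "\<lambda>z p. indicator {z. close m (\<rho> n) z (fst p) (snd p)} z :: ennreal"
  have "(\<integral>\<^sup>+z. mass m z n \<partial>?P) = (\<integral>\<^sup>+z. ?c * (\<integral>\<^sup>+p. ?I z p \<partial>(\<mu> \<Otimes>\<^sub>M \<mu>)) \<partial>?P)"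
  proof (rule nn_integral_cong)
    fix z assume z[measurable]: "z \<in> space ?P"
    have "(\<integral>\<^sup>+p. ?I z p \<partial>(\<mu> \<Otimes>\<^sub>M \<mu>)) = (\<integral>\<^sup>+y. \<integral>\<^sup>+y'. ?I z (y, y') \<partial>\<mu> \<partial>\<mu>)"
      by (rule mu.nn_integral_fst[symmetric]) measurable
    then show "mass m z n = ?c * (\<integral>\<^sup>+p. ?I z p \<partial>(\<mu> \<Otimes>\<^sub>M \<mu>))"
      by (simp add: mass_def)
  qed
  also have "\<dots> = ?c * (\<integral>\<^sup>+z. \<integral>\<^sup>+p. ?I z p \<partial>(\<mu> \<Otimes>\<^sub>M \<mu>) \<partial>?P)"
    by (rule nn_integral_cmult) measurable
  also have "(\<integral>\<^sup>+z. \<integral>\<^sup>+p. ?I z p \<partial>(\<mu> \<Otimes>\<^sub>M \<mu>) \<partial>?P) = (\<integral>\<^sup>+p. \<integral>\<^sup>+z. ?I z p \<partial>?P \<partial>(\<mu> \<Otimes>\<^sub>M \<mu>))"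
    by (rule B.Fubini') measurable
  also have "\<dots> \<le> (\<integral>\<^sup>+p. ennreal ((K * M / 2 * \<rho> n) ^ Suc m) * ennreal (1 / norm (fst p - snd p) ^ Suc m) \<partial>(\<mu> \<Otimes>\<^sub>M \<mu>))"
  proof (rule nn_integral_mono_AE)
    have [measurable]: "E \<in> sets borel" using compact_E by (simp add: borel_closed compact_imp_closed)
    have "AE p in \<mu> \<Otimes>\<^sub>M \<mu>. fst p \<in> E \<and> snd p \<in> E"
    proof (rule mu2.AE_pair_measure)
      show "{p \<in> space (\<mu> \<Otimes>\<^sub>M \<mu>). fst p \<in> E \<and> snd p \<in> E} \<in> sets (\<mu> \<Otimes>\<^sub>M \<mu>)" by measurable
      show "AE y in \<mu>. AE y' in \<mu>. fst (y, y') \<in> E \<and> snd (y, y') \<in> E"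
        using AE_E by eventually_elim (use AE_E in simp)
    qed
    then show "AE p in \<mu> \<Otimes>\<^sub>M \<mu>. (\<integral>\<^sup>+z. ?I z p \<partial>?P)
        \<le> ennreal ((K * M / 2 * \<rho> n) ^ Suc m) * ennreal (1 / norm (fst p - snd p) ^ Suc m)"
      using AE_neq by eventually_elim (rule nn_integral_close_le, auto simp: rho_pos)
  qed
  also have "\<dots> = ennreal ((K * M / 2 * \<rho> n) ^ Suc m) * (\<integral>\<^sup>+p. ennreal (1 / norm (fst p - snd p) ^ Suc m) \<partial>(\<mu> \<Otimes>\<^sub>M \<mu>))"
    by (rule nn_integral_cmult) measurable
  finally have "(\<integral>\<^sup>+z. mass m z n \<partial>?P)
    \<le> ?c * (ennreal ((K * M / 2 * \<rho> n) ^ Suc m) * (\<integral>\<^sup>+p. ennreal (1 / norm (fst p - snd p) ^ Suc m) \<partial>(\<mu> \<Otimes>\<^sub>M \<mu>)))"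
    by (simp add: mult_left_mono)
  also have "\<dots> = (?c * ennreal ((K * M / 2 * \<rho> n) ^ Suc m)) * (\<integral>\<^sup>+p. ennreal (1 / norm (fst p - snd p) ^ Suc m) \<partial>(\<mu> \<Otimes>\<^sub>M \<mu>))"
    by (simp only: mult.assoc)
  also have "?c * ennreal ((K * M / 2 * \<rho> n) ^ Suc m) = ennreal ((K * M / 2) ^ Suc m)"
    using rho_pos[of n] K_nonneg M_pos
    by (simp add: ennreal_mult[symmetric] power_mult_distrib[symmetric] del: power_Suc)
  finally show ?thesis .
qed

text \<open>By Fatou the lower limit of the correlation integrals has finite mean over base tuples,
  the energy of order \<open>Suc m\<close> being available since m < k. Integrating over the zeroth
  point last gives a full set of x, and for each of them a full set of the remaining base
  points.\<close>

lemma AE_layer_absolutely_continuous: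
  assumes m: "m < k"
  shows "AE x in \<mu>. AE z in measure_power m \<mu>.
    absolutely_continuous (Pi\<^sub>M (dist_layer m) (\<lambda>_. lborel)) (layer_measure m (z(0 := x)))"
proof -
  let ?P = "Pi\<^sub>M {..m} (\<lambda>_. \<mu>)"
  have ins: "{..m} = insert 0 {1..m}" by auto
  define G where "G z = liminf (mass m z)" for z
  have G[measurable]: "G \<in> borel_measurable ?P"
    unfolding G_def by measurable
  interpret F: finite_product_sigma_finite "\<lambda>_::nat. \<mu>" "{1..m}" by standard simp
  have Gm: "(\<lambda>p. G ((snd p)(0 := fst p))) \<in> borel_measurable (\<mu> \<Otimes>\<^sub>M Pi\<^sub>M {1..m} (\<lambda>_. \<mu>))"
  proof -
    have "(\<lambda>p. (snd p)(0 := fst p)) \<in> measurable (\<mu> \<Otimes>\<^sub>M Pi\<^sub>M {1..m} (\<lambda>_. \<mu>)) (Pi\<^sub>M (insert 0 {1..m}) (\<lambda>_. \<mu>))"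
      by measurable
    then show ?thesis using G unfolding ins by (rule measurable_compose)
  qed
  let ?En = "\<integral>\<^sup>+p. ennreal (1 / norm (fst p - snd p) ^ Suc m) \<partial>(\<mu> \<Otimes>\<^sub>M \<mu>)"
  have "(\<integral>\<^sup>+x. \<integral>\<^sup>+z. G (z(0 := x)) \<partial>(Pi\<^sub>M {1..m} (\<lambda>_. \<mu>)) \<partial>\<mu>) = (\<integral>\<^sup>+z. G z \<partial>?P)"
    using G unfolding ins by (intro product_nn_integral_insert_rev[symmetric]) auto
  also have "\<dots> \<le> liminf (\<lambda>n. \<integral>\<^sup>+z. mass m z n \<partial>?P)"
    unfolding G_def by (rule nn_integral_liminf) measurable
  also have "\<dots> \<le> liminf (\<lambda>n. ennreal ((K * M / 2) ^ Suc m) * ?En)"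
    by (intro Liminf_mono always_eventually allI nn_integral_mass_le)
  also have "\<dots> = ennreal ((K * M / 2) ^ Suc m) * ?En"
    by (simp add: Liminf_const)
  also have "\<dots> < \<infinity>"
    using energy[of "Suc m"] m by (simp add: ennreal_mult_less_top)
  finally have "(\<integral>\<^sup>+x. \<integral>\<^sup>+z. G (z(0 := x)) \<partial>(Pi\<^sub>M {1..m} (\<lambda>_. \<mu>)) \<partial>\<mu>) \<noteq> \<infinity>" by simp
  then have "AE x in \<mu>. (\<integral>\<^sup>+z. G (z(0 := x)) \<partial>(Pi\<^sub>M {1..m} (\<lambda>_. \<mu>))) \<noteq> \<infinity>"
    using F.borel_measurable_nn_integral_fst[OF Gm] by (intro nn_integral_noteq_infinite) simp_all
  then show ?thesis
  proof (eventually_elim)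
    fix x assume fin: "(\<integral>\<^sup>+z. G (z(0 := x)) \<partial>(Pi\<^sub>M {1..m} (\<lambda>_. \<mu>))) \<noteq> \<infinity>"
    have "(\<lambda>z. G (z(0 := x))) \<in> borel_measurable (Pi\<^sub>M {1..m} (\<lambda>_. \<mu>))"
      using measurable_compose[OF measurable_Pair1' Gm, of x] by (simp add: space_mu)
    then have "AE z in Pi\<^sub>M {1..m} (\<lambda>_. \<mu>). G (z(0 := x)) \<noteq> \<infinity>"
      using fin by (rule nn_integral_noteq_infinite)
    then show "AE z in measure_power m \<mu>.
       absolutely_continuous (Pi\<^sub>M (dist_layer m) (\<lambda>_. lborel)) (layer_measure m (z(0 := x)))"
      unfolding measure_power_def G_def
      by eventually_elim (rule layer_absolutely_continuous, simp add: less_top)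
  qed
qed

section \<open>Assembling the layers into the full distance tuple\<close>

definition gauge_map :: "nat \<Rightarrow> 'a \<Rightarrow> (nat \<Rightarrow> 'a) \<Rightarrow> (nat \<times> nat \<Rightarrow> real)" where
  "gauge_map j x z = (\<lambda>(a, b)\<in>dist_pairs j. h (norm ((z(0 := x)) a - (z(0 := x)) b)))"

lemma measurable_gauge_map[measurable]:
  "gauge_map j x \<in> measurable (measure_power j \<mu>) (lebesgue_tuples j)"
  unfolding gauge_map_def lebesgue_tuples_def
proof (rule measurable_restrict)
  have c: "(\<lambda>z. (z(0 := x)) i) \<in> borel_measurable (measure_power j \<mu>)" if "i \<le> j" for i
  proof (cases "i = 0")
    case False
    with that have "(\<lambda>z. z i) \<in> measurable (measure_power j \<mu>) \<mu>"
      unfolding measure_power_def by (intro measurable_component_singleton) auto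
    then have "(\<lambda>z. z i) \<in> borel_measurable (measure_power j \<mu>)"
      using sets_mu measurable_cong_sets by blast
    then show ?thesis using False by simp
  qed simp
  fix p assume "p \<in> dist_pairs j"
  then obtain a b where p: "p = (a, b)" "a \<le> j" "b \<le> j"
    by (auto simp: dist_pairs_def)
  have [measurable]: "(\<lambda>z. (z(0 := x)) a) \<in> borel_measurable (measure_power j \<mu>)"
    "(\<lambda>z. (z(0 := x)) b) \<in> borel_measurable (measure_power j \<mu>)"
    using c p by auto
  show "(\<lambda>z. case p of (a, b) \<Rightarrow> h (norm ((z(0 := x)) a - (z(0 := x)) b))) \<in> measurable (measure_power j \<mu>) lborel"
    unfolding p prod.case measurable_lborel1 by measurable
qed

text \<open>Only the layer depends on the new point, so that slicing the target space matches
  integrating over the new point.\<close>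

lemma gauge_map_Suc:
  "gauge_map (Suc j) x (z(Suc j := y)) = merge (dist_pairs j) (dist_layer j) (gauge_map j x z, layer j (z(0 := x)) y)"
proof
  fix p :: "nat \<times> nat"
  obtain a b where p: "p = (a, b)" by (cases p)
  consider "a < b" "b \<le> j" | "a \<le> j" "b = Suc j" | "p \<notin> dist_pairs (Suc j)"
    using p by (cases "a < b \<and> b \<le> Suc j") (auto simp: dist_pairs_def le_Suc_eq)
  then show "gauge_map (Suc j) x (z(Suc j := y)) p
      = merge (dist_pairs j) (dist_layer j) (gauge_map j x z, layer j (z(0 := x)) y) p"
  proof cases
    case 1
    then have "p \<in> dist_pairs j" "p \<in> dist_pairs (Suc j)" using p by (auto simp: dist_pairs_def)
    then show ?thesis using 1 by (simp add: p gauge_map_def merge_def)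
  next
    case 2
    then have "p \<notin> dist_pairs j" "p \<in> dist_layer j" "p \<in> dist_pairs (Suc j)"
      using p by (auto simp: dist_pairs_def dist_layer_def)
    then show ?thesis using 2 by (simp add: p gauge_map_def layer_def merge_def)
  next
    case 3
    then have "p \<notin> dist_pairs j" "p \<notin> dist_layer j"
      by (auto simp: dist_pairs_Suc)
    then show ?thesis using 3 by (simp add: gauge_map_def merge_def)
  qed
qed

text \<open>Almost every slice of N is null. By induction the old distances almost surely avoid the
  exceptional parameters, and absolute continuity of the layer then makes the new distances avoid
  the slice.\<close>

lemma gauge_map_null:
  assumes good: "\<And>m. m < j \<Longrightarrow> AE z in measure_power m \<mu>.
      absolutely_continuous (Pi\<^sub>M (dist_layer m) (\<lambda>_. lborel)) (layer_measure m (z(0 := x)))"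
    and N: "N \<in> null_sets (lebesgue_tuples j)"
  shows "AE z in measure_power j \<mu>. gauge_map j x z \<notin> N"
  using assms
proof (induction j arbitrary: N)
  case 0
  have "dist_pairs 0 = {}" by (auto simp: dist_pairs_def)
  \<comment> \<open>With no coordinates the space is a single point of mass 1, so its only null set
    is empty.\<close>
  then have "lebesgue_tuples 0 = count_space {\<lambda>_. undefined}"
    by (simp add: lebesgue_tuples_def PiM_empty)
  with 0(2) have "N = {}"
    by (auto simp: null_sets_def emeasure_count_space_eq_0)
  then show ?case by simp
next
  case (Suc j)
  let ?L = "\<lambda>I. Pi\<^sub>M I (\<lambda>_. lborel :: real measure)"
  interpret L: product_sigma_finite "\<lambda>_::nat \<times> nat. lborel :: real measure" ..
  interpret LJ: finite_product_sigma_finite "\<lambda>_::nat \<times> nat. lborel :: real measure" "dist_layer j" by standard simp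
  interpret Fj: finite_product_sigma_finite "\<lambda>_::nat. \<mu>" "{1..j}" by standard simp
  have N[measurable]: "N \<in> sets (?L (dist_pairs j \<union> dist_layer j))"
    and N0: "emeasure (?L (dist_pairs j \<union> dist_layer j)) N = 0"
    using Suc.prems(2) by (auto simp: lebesgue_tuples_def dist_pairs_Suc)
  \<comment> \<open>Lebesgue measure of the slice of N over the old distances t.\<close>
  define g where "g t = (\<integral>\<^sup>+s. indicator N (merge (dist_pairs j) (dist_layer j) (t, s)) \<partial>(?L (dist_layer j)))" for t
  have mm: "(\<lambda>p. indicator N (merge (dist_pairs j) (dist_layer j) p) :: ennreal)
      \<in> borel_measurable (?L (dist_pairs j) \<Otimes>\<^sub>M ?L (dist_layer j))"
    by (rule measurable_compose[OF measurable_merge]) simp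
  have g[measurable]: "g \<in> borel_measurable (lebesgue_tuples j)"
    unfolding g_def lebesgue_tuples_def by (rule LJ.borel_measurable_nn_integral_fst[OF mm])
  have "(\<integral>\<^sup>+t. g t \<partial>(lebesgue_tuples j)) = (\<integral>\<^sup>+v. indicator N v \<partial>(?L (dist_pairs j \<union> dist_layer j)))"
    unfolding g_def lebesgue_tuples_def
    by (rule L.product_nn_integral_fold[symmetric, OF dist_pairs_layer_disjoint finite_dist_pairs finite_dist_layer]) simp
  also have "\<dots> = 0" using N0 by simp
  finally have "AE t in lebesgue_tuples j. g t = 0" by (simp add: nn_integral_0_iff_AE)
  then obtain N1 where N1: "N1 \<in> null_sets (lebesgue_tuples j)" "{t\<in>space (lebesgue_tuples j). g t \<noteq> 0} \<subseteq> N1"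
    by (auto simp: eventually_ae_filter)
  have IH: "AE z in measure_power j \<mu>. gauge_map j x z \<notin> N1"
    using Suc.IH[of N1] Suc.prems(1) N1(1) by (simp add: less_SucI)
  have ae: "AE z in measure_power j \<mu>. g (gauge_map j x z) = 0"
    using IH AE_space
  proof eventually_elim
    fix z assume z: "gauge_map j x z \<notin> N1" "z \<in> space (measure_power j \<mu>)"
    have "gauge_map j x z \<in> space (lebesgue_tuples j)"
      using measurable_space[OF measurable_gauge_map z(2)] .
    with z(1) N1(2) show "g (gauge_map j x z) = 0" by auto
  qed
  have inner: "AE z in measure_power j \<mu>. (\<integral>\<^sup>+y. indicator N (gauge_map (Suc j) x (z(Suc j := y))) \<partial>\<mu>) = 0"
    using ae Suc.prems(1)[of j, OF lessI] AE_space
  proof eventually_elim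
    fix z assume z: "g (gauge_map j x z) = 0" "z \<in> space (measure_power j \<mu>)"
      and ac: "absolutely_continuous (?L (dist_layer j)) (layer_measure j (z(0 := x)))"
    let ?t = "gauge_map j x z"
    let ?f = "\<lambda>s. indicator N (merge (dist_pairs j) (dist_layer j) (?t, s)) :: ennreal"
    have t: "?t \<in> space (?L (dist_pairs j))"
      using measurable_space[OF measurable_gauge_map z(2)] by (simp add: lebesgue_tuples_def)
    have f[measurable]: "?f \<in> borel_measurable (?L (dist_layer j))"
      using measurable_compose[OF measurable_Pair1'[OF t] mm] .
    have "AE s in ?L (dist_layer j). ?f s = 0"
      using z(1) unfolding g_def by (simp add: nn_integral_0_iff_AE)
    then have "AE s in layer_measure j (z(0 := x)). ?f s = 0"
      by (rule absolutely_continuous_AE[OF _ ac, rotated]) (simp add: layer_measure_def)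
    then have "(\<integral>\<^sup>+s. ?f s \<partial>layer_measure j (z(0 := x))) = 0"
      by (subst nn_integral_0_iff_AE) (auto simp: layer_measure_def)
    then show "(\<integral>\<^sup>+y. indicator N (gauge_map (Suc j) x (z(Suc j := y))) \<partial>\<mu>) = 0"
      unfolding layer_measure_def gauge_map_Suc by (simp add: nn_integral_distr)
  qed
  have ins: "{1..Suc j} = insert (Suc j) {1..j}" by auto
  have N': "N \<in> sets (lebesgue_tuples (Suc j))" using Suc.prems(2) by auto
  have meas: "(\<lambda>z. indicator N (gauge_map (Suc j) x z) :: ennreal) \<in> borel_measurable (measure_power (Suc j) \<mu>)"
    by (rule measurable_compose[OF measurable_gauge_map]) (use N' in simp)
  have "(\<integral>\<^sup>+z. indicator N (gauge_map (Suc j) x z) \<partial>(measure_power (Suc j) \<mu>))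
      = (\<integral>\<^sup>+z. \<integral>\<^sup>+y. indicator N (gauge_map (Suc j) x (z(Suc j := y))) \<partial>\<mu> \<partial>(measure_power j \<mu>))"
    using meas unfolding measure_power_def ins by (intro product_nn_integral_insert) auto
  also have "\<dots> = (\<integral>\<^sup>+z. 0 \<partial>(measure_power j \<mu>))"
    by (rule nn_integral_cong_AE[OF inner])
  finally have "AE z in measure_power (Suc j) \<mu>. indicator N (gauge_map (Suc j) x z) = (0::ennreal)"
    using meas by (simp add: nn_integral_0_iff_AE)
  then show ?case by eventually_elim (simp add: indicator_def split: if_splits)
qed

text \<open>The exceptional x are those of finitely many absolute continuity statements, none of
  which mentions N; this allows the quantifier over N inside.\<close>

theorem AE_gauge_map_null:
  "AE x in \<mu>. \<forall>N\<in>null_sets (lebesgue_tuples k). AE z in measure_power k \<mu>. gauge_map k x z \<notin> N"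
proof -
  have "AE x in \<mu>. \<forall>m\<in>{..<k}. AE z in measure_power m \<mu>.
      absolutely_continuous (Pi\<^sub>M (dist_layer m) (\<lambda>_. lborel)) (layer_measure m (z(0 := x)))"
    by (intro AE_finite_allI) (auto intro: AE_layer_absolutely_continuous)
  then show ?thesis
    by eventually_elim (auto intro: gauge_map_null)
qed

end

subsection \<open>Affinely independent tuples\<close>

lemma sets_PiM_UN_compact:
  fixes M :: "'i::countable \<Rightarrow> 'a::{second_countable_topology,metric_space} measure" and C :: "nat \<Rightarrow> ('i \<Rightarrow> 'a) set"
  assumes M: "\<And>i. i \<in> I \<Longrightarrow> sets (M i) = sets borel"
    and C: "\<And>n. compact (C n)" "(\<Union>n. C n) \<subseteq> space (Pi\<^sub>M I M)"
  shows "(\<Union>n. C n) \<in> sets (Pi\<^sub>M I M)"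
proof -
  have "C n \<in> sets borel" for n
    using C(1) by (intro borel_closed compact_imp_closed)
  then have "(\<Union>n. C n) \<in> sets borel" by auto
  from measurable_sets[OF measurable_PiM_borel[OF M] this]
  have "(\<Union>n. C n) \<inter> space (Pi\<^sub>M I M) \<in> sets (Pi\<^sub>M I M)" by simp
  with C(2) show ?thesis by (simp add: Int_absorb2)
qed

lemma compact_PiE_UNIV:
  fixes S :: "'i \<Rightarrow> 'a::topological_space set"
  assumes "\<And>i. compact (S i)"
  shows "compact (Pi\<^sub>E UNIV S)"
proof -
  have "compactin (product_topology (\<lambda>i. euclidean) UNIV) (Pi\<^sub>E UNIV S)"
    using assms by (auto simp: compactin_PiE)
  then show ?thesis by (simp add: euclidean_product_topology)
qed

text \<open>Existence of a dual family is a closed condition on pairs of families, so it exhibits the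
  affinely independent tuples in a compact set as a countable union of compact sets.\<close>

definition has_dual :: "nat \<Rightarrow> 'a::real_inner \<Rightarrow> (nat \<Rightarrow> 'a) \<Rightarrow> bool" where
  "has_dual j x z \<longleftrightarrow> (\<exists>w. \<forall>i\<in>{1..j}. \<forall>l\<in>{1..j}. w i \<bullet> (z l - x) = (if i = l then 1 else 0))"

lemma has_dual_cong: "(\<And>i. i \<in> {1..j} \<Longrightarrow> z i = z' i) \<Longrightarrow> has_dual j x z = has_dual j x z'"
  unfolding has_dual_def by (intro ex_cong1 ball_cong refl) simp

text \<open>Pairing a linear relation among the differences z l - x with a dual vector isolates one
  coefficient. Conversely, the coordinate functionals of an independent family extend linearly and
  are represented by vectors through the adjoint.\<close>

lemma has_dual_iff_affine_independent:
  fixes x :: "'a::euclidean_space"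
  assumes z0: "z 0 = x"
  shows "has_dual k x z \<longleftrightarrow> inj_on z {0..k} \<and> \<not> affine_dependent (z ` {0..k})"
proof -
  have ins: "{0..k} = insert 0 {1..k}" by auto
  define v where "v l = z l - x" for l
  have v_inj: "inj_on v {1..k} \<longleftrightarrow> inj_on z {1..k}" by (simp add: inj_on_def v_def)
  have *: "inj_on z {0..k} \<and> \<not> affine_dependent (z ` {0..k})
     \<longleftrightarrow> inj_on v {1..k} \<and> x \<notin> z ` {1..k} \<and> independent (v ` {1..k})"
  proof (cases "x \<in> z ` {1..k}")
    case True
    then show ?thesis unfolding ins using z0 by (auto simp: inj_on_insert)
  next
    case False
    have "(\<lambda>y. - x + y) ` z ` {1..k} = v ` {1..k}"
      by (auto simp: v_def image_image)
    then show ?thesis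
      using False affine_dependent_iff_dependent[OF False] unfolding ins v_inj
      by (auto simp: z0 inj_on_insert)
  qed
  show ?thesis unfolding *
  proof
    assume "has_dual k x z"
    then obtain w where w: "\<And>i l. i \<in> {1..k} \<Longrightarrow> l \<in> {1..k} \<Longrightarrow> w i \<bullet> v l = (if i = l then 1 else 0)"
      unfolding has_dual_def v_def by blast
    have inj: "inj_on v {1..k}"
      by (rule inj_onI) (metis w zero_neq_one)
    moreover have "x \<notin> z ` {1..k}"
    proof
      assume "x \<in> z ` {1..k}"
      then obtain l where "l \<in> {1..k}" "v l = 0" by (auto simp: v_def)
      then show False using w[of l l] by simp
    qed
    moreover have "independent (v ` {1..k})"
    proof
      assume "dependent (v ` {1..k})"
      then obtain u l where u: "l \<in> {1..k}" "u (v l) \<noteq> 0" "(\<Sum>y\<in>v ` {1..k}. u y *\<^sub>R y) = 0"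
        by (auto simp: dependent_finite)
      have "0 = w l \<bullet> (\<Sum>y\<in>v ` {1..k}. u y *\<^sub>R y)" using u(3) by simp
      also have "\<dots> = (\<Sum>i\<in>{1..k}. u (v i) * (w l \<bullet> v i))"
        by (subst sum.reindex[OF inj]) (simp add: inner_sum_right)
      also have "\<dots> = (\<Sum>i\<in>{1..k}. if i = l then u (v i) else 0)"
        using u(1) w by (intro sum.cong) auto
      also have "\<dots> = u (v l)" using u(1) by simp
      finally show False using u(2) by simp
    qed
    ultimately show "inj_on v {1..k} \<and> x \<notin> z ` {1..k} \<and> independent (v ` {1..k})" by blast
  next
    assume a: "inj_on v {1..k} \<and> x \<notin> z ` {1..k} \<and> independent (v ` {1..k})"
    have "\<exists>w. \<forall>l\<in>{1..k}. w \<bullet> v l = (if i = l then 1 else 0)" if "i \<in> {1..k}" for i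
    proof -
      obtain g :: "'a \<Rightarrow> real" where g: "linear g" "\<And>y. y \<in> v ` {1..k} \<Longrightarrow> g y = (if y = v i then 1 else 0)"
        using linear_independent_extend[of "v ` {1..k}" "\<lambda>y. if y = v i then 1 else 0 :: real"] a by blast
      have "adjoint g 1 \<bullet> v l = (if i = l then 1 else 0)" if "l \<in> {1..k}" for l
        using g(2)[of "v l"] that \<open>i \<in> {1..k}\<close> a adjoint_works[OF g(1), of "v l" 1]
        by (auto simp: inner_commute inj_on_eq_iff)
      then show ?thesis by blast
    qed
    then show "has_dual k x z"
      unfolding has_dual_def v_def by metis
  qed
qed

definition nondeg_tuples :: "nat \<Rightarrow> 'a::real_inner \<Rightarrow> 'a set \<Rightarrow> (nat \<Rightarrow> 'a) set" where
  "nondeg_tuples j x E = {z \<in> Pi\<^sub>E {1..j} (\<lambda>_. E). has_dual j x z}"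

text \<open>Bounding the dual family by n makes the closed set of pairs compact, and projection to
  the tuple keeps it compact; every dual family is bounded by some n.\<close>

lemma nondeg_tuples_UN_compact:
  fixes x :: "'a::euclidean_space"
  assumes E: "compact E"
  obtains C :: "nat \<Rightarrow> (nat \<Rightarrow> 'a) set" where "\<And>n. compact (C n)" "nondeg_tuples j x E = (\<Union>n. C n)"
proof -
  \<comment> \<open>Writing extensional functions as a product over all indices, with singletons
    outside the range, makes Tychonoff's theorem applicable.\<close>
  define A where "A = Pi\<^sub>E UNIV (\<lambda>i. if i \<in> {1..j} then E else {undefined})"
  define B where "B n = Pi\<^sub>E UNIV (\<lambda>i. if i \<in> {1..j} then cball (0::'a) (real n) else {0})" for n
  define D :: "((nat \<Rightarrow> 'a) \<times> (nat \<Rightarrow> 'a)) set" where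
    "D = {p. \<forall>i\<in>{1..j}. \<forall>l\<in>{1..j}. snd p i \<bullet> (fst p l - x) = (if i = l then 1 else 0)}"
  have A: "A = Pi\<^sub>E {1..j} (\<lambda>_. E)"
    by (auto simp: A_def PiE_iff extensional_def split: if_splits)
  have "closed D"
  proof -
    have "closed {p :: (nat \<Rightarrow> 'a) \<times> (nat \<Rightarrow> 'a). snd p i \<bullet> (fst p l - x) = (if i = l then 1 else 0)}" for i l
      by (intro closed_Collect_eq continuous_intros continuous_on_product_then_coordinatewise)
    then show ?thesis unfolding D_def Collect_ball_eq by (intro closed_INT ballI)
  qed
  moreover have "compact (A \<times> B n)" for n
    unfolding A_def B_def by (intro compact_Times compact_PiE_UNIV) (use E in auto)
  ultimately have "compact (fst ` ((A \<times> B n) \<inter> D))" for n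
    by (intro compact_continuous_image compact_Int_closed continuous_intros)
  moreover have "nondeg_tuples j x E = (\<Union>n. fst ` ((A \<times> B n) \<inter> D))"
  proof safe
    fix z assume z: "z \<in> nondeg_tuples j x E"
    then obtain w where w: "\<forall>i\<in>{1..j}. \<forall>l\<in>{1..j}. w i \<bullet> (z l - x) = (if i = l then 1 else 0)"
      by (auto simp: nondeg_tuples_def has_dual_def)
    obtain n :: nat where n: "Max (insert 0 ((\<lambda>i. norm (w i)) ` {1..j})) < real n"
      using reals_Archimedean2 by blast
    define w' where "w' i = (if i \<in> {1..j} then w i else 0)" for i
    have "w' \<in> B n" using n by (auto simp: B_def w'_def less_imp_le)
    moreover have "z \<in> A" using z by (simp add: A nondeg_tuples_def)
    moreover have "(z, w') \<in> D" using w by (auto simp: D_def w'_def)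
    ultimately have "z \<in> fst ` ((A \<times> B n) \<inter> D)" by force
    then show "z \<in> (\<Union>n. fst ` ((A \<times> B n) \<inter> D))" by blast
  next
    fix n z w assume "z \<in> A" "w \<in> B n" "(z, w) \<in> D"
    then have "z \<in> Pi\<^sub>E {1..j} (\<lambda>_. E)"
      "\<forall>i\<in>{1..j}. \<forall>l\<in>{1..j}. w i \<bullet> (z l - x) = (if i = l then 1 else 0)"
      unfolding A D_def by simp_all
    then show "fst (z, w) \<in> nondeg_tuples j x E"
      unfolding nondeg_tuples_def has_dual_def fst_conv mem_Collect_eq by blast
  qed
  ultimately show thesis by (rule that)
qed

text \<open>Rescaling w gives the dual vector of the new difference. Subtracting multiples of it
  from the old dual vectors makes these vanish there and leaves their old pairings intact.\<close>

lemma has_dual_extend: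
  fixes x :: "'a::euclidean_space"
  assumes z: "has_dual j x z" and w: "\<And>i. i \<in> {1..j} \<Longrightarrow> w \<bullet> (z i - x) = 0" and y: "w \<bullet> (y - x) \<noteq> 0"
  shows "has_dual (Suc j) x (z(Suc j := y))"
proof -
  obtain u where u: "\<And>i l. i \<in> {1..j} \<Longrightarrow> l \<in> {1..j} \<Longrightarrow> u i \<bullet> (z l - x) = (if i = l then 1 else 0)"
    using z unfolding has_dual_def by blast
  define w0 where "w0 = (1 / (w \<bullet> (y - x))) *\<^sub>R w"
  have w0: "w0 \<bullet> (y - x) = 1" "\<And>i. i \<in> {1..j} \<Longrightarrow> w0 \<bullet> (z i - x) = 0"
    using y w by (auto simp: w0_def)
  define u' where "u' i = (if i = Suc j then w0 else u i - (u i \<bullet> (y - x)) *\<^sub>R w0)" for i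
  have "u' i \<bullet> ((z(Suc j := y)) l - x) = (if i = l then 1 else 0)" if "i \<in> {1..Suc j}" "l \<in> {1..Suc j}" for i l
  proof -
    have "l \<in> {1..j} \<or> l = Suc j" "i \<in> {1..j} \<or> i = Suc j" using that by auto
    moreover have "Suc j \<notin> {1..j}" by simp
    ultimately show ?thesis
      by (auto simp del: atLeastAtMost_iff simp: u'_def w0 u inner_diff_left[of "u _"])
  qed
  then show ?thesis unfolding has_dual_def by blast
qed

section \<open>Degenerate tuples are negligible\<close>

context slab_measure
begin

text \<open>A hyperplane lies in slabs of arbitrarily small width.\<close>

lemma AE_hyperplane:
  assumes w: "w \<noteq> 0"
  shows "AE y in \<mu>. y \<bullet> w \<noteq> c"
proof (rule AE_I)
  have S: "{y. \<bar>y \<bullet> w - c\<bar> \<le> r} \<in> sets \<mu>" for r unfolding sets_mu by measurable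
  show "{y. y \<bullet> w = c} \<in> sets \<mu>" unfolding sets_mu by measurable
  have "emeasure \<mu> {y. y \<bullet> w = c} \<le> ennreal (K * (1 / real (Suc n)) / norm w)" for n
  proof -
    have "emeasure \<mu> {y. y \<bullet> w = c} \<le> emeasure \<mu> {y. \<bar>y \<bullet> w - c\<bar> \<le> 1 / real (Suc n)}"
      by (rule emeasure_mono[OF _ S]) auto
    also have "\<dots> \<le> ennreal (K * (1 / real (Suc n)) / norm w)"
      using w by (intro slab) auto
    finally show ?thesis .
  qed
  moreover have "(\<lambda>n. ennreal (K * (1 / real (Suc n)) / norm w)) \<longlonglongrightarrow> ennreal (K * 0 / norm w)"
    using w by (intro tendsto_ennrealI tendsto_intros LIMSEQ_Suc[OF lim_1_over_n]) auto
  ultimately have "emeasure \<mu> {y. y \<bullet> w = c} \<le> ennreal (K * 0 / norm w)"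
    by (intro LIMSEQ_le_const) auto
  then show "emeasure \<mu> {y. y \<bullet> w = c} = 0" by simp
qed auto

lemma sets_nondeg_tuples[measurable]: "nondeg_tuples j x E \<in> sets (measure_power j \<mu>)"
proof -
  obtain C :: "nat \<Rightarrow> (nat \<Rightarrow> 'a) set" where C: "\<And>n. compact (C n)" "nondeg_tuples j x E = (\<Union>n. C n)"
    using nondeg_tuples_UN_compact[OF compact_E] by blast
  have "nondeg_tuples j x E \<subseteq> space (measure_power j \<mu>)"
    by (auto simp: nondeg_tuples_def measure_power_def space_PiM space_mu)
  then show ?thesis
    unfolding C(2) measure_power_def by (intro sets_PiM_UN_compact sets_mu C(1))
qed

text \<open>A new point outside the hyperplane through x orthogonal to some w that annihilates the
  old differences preserves independence, and that hyperplane is null.\<close>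

lemma AE_nondeg_tuples:
  assumes "j \<le> DIM('a)"
  shows "AE z in measure_power j \<mu>. z \<in> nondeg_tuples j x E"
  using assms
proof (induction j)
  case 0
  have "nondeg_tuples 0 x E = space (measure_power 0 \<mu>)"
    by (auto simp: nondeg_tuples_def has_dual_def measure_power_def space_PiM)
  then show ?case by (simp add: AE_space)
next
  case (Suc j)
  have ins: "{1..Suc j} = insert (Suc j) {1..j}" by auto
  let ?f = "\<lambda>z. indicator (- nondeg_tuples (Suc j) x E) z :: ennreal"
  have f: "?f \<in> borel_measurable (measure_power (Suc j) \<mu>)"
    by (intro borel_measurable_indicator') simp
  have "AE z in measure_power j \<mu>. z \<in> nondeg_tuples j x E" using Suc by simp
  then have inner: "AE z in measure_power j \<mu>. (\<integral>\<^sup>+y. ?f (z(Suc j := y)) \<partial>\<mu>) = 0"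
  proof eventually_elim
    fix z assume z: "z \<in> nondeg_tuples j x E"
    \<comment> \<open>Fewer than d differences leave room for a nonzero orthogonal w.\<close>
    have "dim ((\<lambda>i. z i - x) ` {1..j}) \<le> card ((\<lambda>i. z i - x) ` {1..j})"
      by (rule dim_le_card') simp
    also have "\<dots> \<le> j" using card_image_le[of "{1..j}" "\<lambda>i. z i - x"] by simp
    also have "\<dots> < DIM('a)" using Suc.prems by simp
    finally obtain w where w: "w \<noteq> 0" "\<And>y. y \<in> span ((\<lambda>i. z i - x) ` {1..j}) \<Longrightarrow> orthogonal w y"
      using orthogonal_to_subspace_exists by blast
    have w0: "w \<bullet> (z i - x) = 0" if "i \<in> {1..j}" for i
      using w(2)[OF span_base, OF imageI, OF that] by (simp add: orthogonal_def)
    have "AE y in \<mu>. ?f (z(Suc j := y)) = 0"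
      using AE_hyperplane[OF w(1), of "x \<bullet> w"] AE_E
    proof eventually_elim
      fix y assume y: "y \<bullet> w \<noteq> x \<bullet> w" "y \<in> E"
      have "has_dual (Suc j) x (z(Suc j := y))"
        using z y w0 by (intro has_dual_extend[of j x z w]) (auto simp: nondeg_tuples_def inner_diff_right inner_commute)
      moreover have "z(Suc j := y) \<in> Pi\<^sub>E {1..Suc j} (\<lambda>_. E)"
        using z y(2) unfolding ins by (intro PiE_fun_upd) (auto simp: nondeg_tuples_def)
      ultimately show "?f (z(Suc j := y)) = 0" by (simp add: nondeg_tuples_def)
    qed
    then show "(\<integral>\<^sup>+y. ?f (z(Suc j := y)) \<partial>\<mu>) = 0"
      using nn_integral_cong_AE[of "\<lambda>y. ?f (z(Suc j := y))" "\<lambda>_. 0" \<mu>] by simp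
  qed
  have "(\<integral>\<^sup>+z. ?f z \<partial>(measure_power (Suc j) \<mu>)) = (\<integral>\<^sup>+z. \<integral>\<^sup>+y. ?f (z(Suc j := y)) \<partial>\<mu> \<partial>(measure_power j \<mu>))"
    using f unfolding measure_power_def ins by (intro product_nn_integral_insert) auto
  also have "\<dots> = (\<integral>\<^sup>+z. 0 \<partial>(measure_power j \<mu>))"
    by (rule nn_integral_cong_AE[OF inner])
  finally have "AE z in measure_power (Suc j) \<mu>. ?f z = 0"
    using f by (simp add: nn_integral_0_iff_AE)
  then show ?case by eventually_elim (simp add: indicator_def split: if_splits)
qed

end

text \<open>Replaces arbitrary families by extensional tuples with x reinserted at index 0, the form
  that \<open>measure_power\<close> sees.\<close>

lemma nondeg_dist_set_eq:
  fixes x :: "'a::euclidean_space"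
  shows "nondeg_dist_set k x E =
    (\<lambda>z. \<lambda>(a, b)\<in>dist_pairs k. norm ((z(0 := x)) a - (z(0 := x)) b)) ` nondeg_tuples k x E"
proof safe
  fix t assume "t \<in> nondeg_dist_set k x E"
  then obtain z where z: "t = (\<lambda>(a, b)\<in>dist_pairs k. norm (z a - z b))" "z 0 = x" "\<forall>i\<in>{1..k}. z i \<in> E"
    "inj_on z {0..k}" "\<not> affine_dependent (z ` {0..k})"
    by (auto simp: nondeg_dist_set_def)
  have "has_dual k x z" using has_dual_iff_affine_independent[of z x k] z by blast
  then have "has_dual k x (restrict z {1..k})"
    using has_dual_cong[of k z "restrict z {1..k}"] by simp
  then have "restrict z {1..k} \<in> nondeg_tuples k x E"
    using z(3) by (auto simp: nondeg_tuples_def)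
  moreover have "t = (\<lambda>(a, b)\<in>dist_pairs k. norm (((restrict z {1..k})(0 := x)) a - ((restrict z {1..k})(0 := x)) b))"
    unfolding z(1) by (intro restrict_ext) (auto simp: dist_pairs_def z(2))
  ultimately show "t \<in> (\<lambda>z. \<lambda>(a, b)\<in>dist_pairs k. norm ((z(0 := x)) a - (z(0 := x)) b)) ` nondeg_tuples k x E"
    by blast
next
  fix z assume z: "z \<in> nondeg_tuples k x E"
  have "has_dual k x (z(0 := x))"
    using z has_dual_cong[of k z "z(0 := x)" x] by (simp add: nondeg_tuples_def)
  then have "inj_on (z(0 := x)) {0..k}" "\<not> affine_dependent (z(0 := x) ` {0..k})"
    using has_dual_iff_affine_independent[of "z(0 := x)" x k] by auto
  moreover have "\<forall>i\<in>{1..k}. (z(0 := x)) i \<in> E"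
    using z by (auto simp: nondeg_tuples_def)
  ultimately show "(\<lambda>(a, b)\<in>dist_pairs k. norm ((z(0 := x)) a - (z(0 := x)) b)) \<in> nondeg_dist_set k x E"
    unfolding nondeg_dist_set_def by (intro CollectI exI[of _ "z(0 := x)"]) simp
qed

text \<open>A continuous image of a countable union of compact sets. Measurability matters for
  positivity, since \<open>emeasure\<close> is 0 off the sigma-algebra.\<close>

lemma sets_nondeg_dist_set:
  fixes x :: "'a::euclidean_space"
  assumes E: "compact E"
  shows "nondeg_dist_set k x E \<in> sets (lebesgue_tuples k)"
proof -
  obtain C :: "nat \<Rightarrow> (nat \<Rightarrow> 'a) set" where C: "\<And>n. compact (C n)" "nondeg_tuples k x E = (\<Union>n. C n)"
    using nondeg_tuples_UN_compact[OF E] by blast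
  define f :: "(nat \<Rightarrow> 'a) \<Rightarrow> (nat \<times> nat \<Rightarrow> real)" where
    "f z = (\<lambda>(a, b)\<in>dist_pairs k. norm ((z(0 := x)) a - (z(0 := x)) b))" for z
  have c: "continuous_on UNIV (\<lambda>z :: nat \<Rightarrow> 'a. (z(0 := x)) i)" for i
    by (cases "i = 0") simp_all
  have "continuous_on UNIV f"
  proof (rule continuous_on_coordinatewise_then_product)
    fix p :: "nat \<times> nat"
    show "continuous_on UNIV (\<lambda>z. f z p)"
      by (cases "p \<in> dist_pairs k"; cases p) (auto simp: f_def simp del: fun_upd_apply intro!: continuous_intros c)
  qed
  then have "compact (f ` C n)" for n
    using C(1) by (intro compact_continuous_image) (auto intro: continuous_on_subset)
  moreover have "nondeg_dist_set k x E = (\<Union>n. f ` C n)"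
    unfolding nondeg_dist_set_eq C(2) f_def by blast
  moreover have "(\<Union>n. f ` C n) \<subseteq> space (lebesgue_tuples k)"
    by (auto simp: lebesgue_tuples_def space_PiM f_def)
  ultimately show ?thesis
    unfolding lebesgue_tuples_def by (simp only:) (intro sets_PiM_UN_compact; simp)
qed

subsection \<open>Compact Salem sets\<close>

text \<open>Excludes the empty set from the main argument, for which the Fourier dimension would be
  a supremum over no exponents.\<close>

lemma hausdorff_dim_empty: "hausdorff_dim ({} :: 'a::euclidean_space set) = 0"
proof -
  have "hausdorff_measure s ({} :: 'a set) = 0" if "s > 0" for s
  proof -
    have "hausdorff_premeasure s \<delta> ({} :: 'a set) = 0" if "\<delta> > 0" for \<delta>
    proof -
      have "hausdorff_premeasure s \<delta> ({} :: 'a set) \<le> (\<Sum>i. ennreal (diameter ((\<lambda>_. {} :: 'a set) (i :: nat)) powr s))"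
        unfolding hausdorff_premeasure_def using that by (intro INF_lower) auto
      then show ?thesis by simp
    qed
    then show ?thesis unfolding hausdorff_measure_def by (auto intro!: SUP_eq_const)
  qed
  then have "{s. 0 < s \<and> hausdorff_measure s ({} :: 'a set) = 0} = {0<..}" by auto
  then show ?thesis unfolding hausdorff_dim_def by simp
qed

lemma salem_set_decay:
  fixes E :: "'a::euclidean_space set"
  assumes "salem_set E" "hausdorff_dim E > r" "r \<ge> 0"
  obtains \<beta> \<mu> C where "r < \<beta>" "\<beta> \<le> DIM('a)" "borel_prob_on E \<mu>"
    "\<And>\<xi>. cmod (fourier_measure \<mu> \<xi>) \<le> C * (1 + norm \<xi>) powr (- \<beta> / 2)"
proof -
  define X where "X = {\<beta>. 0 \<le> \<beta> \<and> \<beta> \<le> real DIM('a) \<and> (\<exists>\<mu>. borel_prob_on E \<mu> \<and>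
        (\<exists>C. \<forall>\<xi>. cmod (fourier_measure \<mu> \<xi>) \<le> C * (1 + norm \<xi>) powr (- \<beta> / 2)))}"
  have "E \<noteq> {}"
  proof
    assume "E = {}"
    then show False using assms(2,3) hausdorff_dim_empty[where 'a = 'a] by simp
  qed
  then obtain p where p: "p \<in> E" by blast
  \<comment> \<open>An element below the supremum is only guaranteed for a nonempty set; a point
    mass at p admits the exponent 0.\<close>
  have "0 \<in> X"
  proof -
    have "borel_prob_on E (return borel p)"
      unfolding borel_prob_on_def
    proof (intro conjI subsetI)
      fix y assume y: "y \<in> msupport (return borel p)"
      show "y \<in> E"
      proof (rule ccontr)
        assume "y \<notin> E"
        then have "emeasure (return borel p) (- {p}) > 0"
          using y p unfolding msupport_def by (auto simp: open_Compl)
        then show False by simp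
      qed
    qed (auto intro: prob_space_return)
    moreover have "cmod (fourier_measure (return borel p) \<xi>) \<le> 1 * (1 + norm \<xi>) powr (- 0 / 2)" for \<xi>
    proof -
      \<comment> \<open>Needed because \<open>0 powr 0\<close> is 0 and not 1.\<close>
      have "1 + norm \<xi> \<noteq> 0" using norm_ge_zero[of \<xi>] by linarith
      then show ?thesis unfolding fourier_measure_def by (simp add: integral_return)
    qed
    ultimately show ?thesis
      unfolding X_def mem_Collect_eq
      by (intro conjI exI[of _ "return borel p"] exI[of _ "1 :: real"] allI) simp_all
  qed
  moreover have "r < Sup X"
    using assms unfolding salem_set_def fourier_dim_def X_def by simp
  ultimately obtain \<beta> where "\<beta> \<in> X" "r < \<beta>"
    using less_cSupD[of X r] by blast
  then show thesis unfolding X_def using that by blast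
qed

section \<open>Supports of Borel measures and the conclusion\<close>

lemma closed_msupport: "closed (msupport \<mu>)"
proof -
  have "- msupport \<mu> = \<Union>{U. open U \<and> emeasure \<mu> U = 0}"
    by (auto simp: msupport_def zero_less_iff_neq_zero)
  then have "open (- msupport \<mu>)" by (auto intro: open_Union)
  then show ?thesis by (simp add: closed_def)
qed

text \<open>The complement of the support is a union of open null sets; by Lindelof countably many
  of them suffice.\<close>

lemma AE_msupport:
  fixes \<mu> :: "'a::second_countable_topology measure"
  assumes "sets \<mu> = sets borel"
  shows "AE y in \<mu>. y \<in> msupport \<mu>"
proof -
  have eq: "- msupport \<mu> = \<Union>{U. open U \<and> emeasure \<mu> U = 0}"
    by (auto simp: msupport_def zero_less_iff_neq_zero)
  obtain F where F: "F \<subseteq> {U. open U \<and> emeasure \<mu> U = 0}" "countable F"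
    "\<Union>F = \<Union>{U. open U \<and> emeasure \<mu> U = 0}"
    using Lindelof[of "{U. open U \<and> emeasure \<mu> U = 0}"] by blast
  have "\<Union>F \<in> null_sets \<mu>"
  proof -
    have "U \<in> null_sets \<mu>" if "U \<in> F" for U
      using that F(1) assms by (intro null_setsI) (auto intro: borel_open)
    then show ?thesis using null_sets_UN'[OF F(2), of "\<lambda>U. U"] by simp
  qed
  then show ?thesis using F(3) eq by (intro AE_I'[of "\<Union>F"]) auto
qed

theorem theorem1p3:
  fixes E :: "(real ^ 'd) set" and k :: nat
  assumes "CARD('d) \<ge> 3"
    and "2 \<le> k" and "k \<le> CARD('d) - 1"
    and "compact E" and "salem_set E"
    and "hausdorff_dim E > real k"
  shows "\<exists>\<mu> E\<^sub>\<mu>. borel_prob_on E \<mu> \<and>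
           E\<^sub>\<mu> \<in> sets borel \<and> E\<^sub>\<mu> \<subseteq> msupport \<mu> \<and> emeasure \<mu> E\<^sub>\<mu> = 1 \<and>
           (\<forall>x\<in>E\<^sub>\<mu>. absolutely_continuous (lebesgue_tuples k)
                     (distr (measure_power k \<mu>) (lebesgue_tuples k) (Phi k x))) \<and>
           (\<forall>x\<in>E\<^sub>\<mu>. emeasure (lebesgue_tuples k) (nondeg_dist_set k x E) > 0)"
proof -
  obtain \<beta> and \<mu> :: "(real ^ 'd) measure" and C where \<beta>: "real k < \<beta>" "\<beta> \<le> DIM(real ^ 'd)" and \<mu>: "borel_prob_on E \<mu>"
    and dec0: "\<And>\<xi>. cmod (fourier_measure \<mu> \<xi>) \<le> C * (1 + norm \<xi>) powr (- \<beta> / 2)"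
    using salem_set_decay[OF assms(5,6)] by auto
  have prob: "prob_space \<mu>" and sets_mu: "sets \<mu> = sets borel" and supp: "msupport \<mu> \<subseteq> E"
    using \<mu> by (auto simp: borel_prob_on_def)
  interpret prob_space \<mu> by (rule prob)
  have kd: "real k < DIM(real ^ 'd)" using assms(1,3) by simp
  \<comment> \<open>2s is the midpoint of k and \<beta>. Giving up part of the decay keeps 2s
    strictly below d even when \<beta> = d, while 2s > k \<ge> 2 gives s > 1.\<close>
  define s where "s = (k + \<beta>) / 4"
  have s: "s > 1" "2 * s > k" "2 * s < DIM(real ^ 'd)" "s \<le> \<beta> / 2"
    using \<beta> kd assms(2) by (auto simp: s_def)
  have C: "C \<ge> 0"
  proof -
    have "0 \<le> C * (1 + norm (0 :: real ^ 'd)) powr (- \<beta> / 2)"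
      using dec0[of 0] norm_ge_zero order_trans by blast
    then show ?thesis by simp
  qed
  have "cmod (fourier_measure \<mu> \<xi>) \<le> C * (1 + norm \<xi>) powr (- s)" for \<xi>
    using C s by (intro order_trans[OF dec0] mult_left_mono powr_mono) auto
  then obtain C' where dec: "fourier_decay \<mu> s C'"
    using fourier_decay_fourier_measure[of \<mu> C s] s by auto
  obtain K1 where K1: "K1 \<ge> 0" "\<And>w c \<rho>. w \<noteq> 0 \<Longrightarrow> \<rho> > 0 \<Longrightarrow> emeasure \<mu> {y. \<bar>y \<bullet> w - c\<bar> \<le> \<rho>} \<le> ennreal (K1 * \<rho> / norm w)"
    using fourier_decay_slab[OF prob sets_mu dec s(1)] by blast
  obtain K2 where K2: "K2 \<ge> 0"
    "\<And>r. r > 0 \<Longrightarrow> emeasure (\<mu> \<Otimes>\<^sub>M \<mu>) {p. norm (fst p - snd p) \<le> r} \<le> ennreal (K2 * r powr (2 * s))"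
    using fourier_decay_pair[OF prob sets_mu dec _ s(3)] s(1) by auto
  have AE_E: "AE y in \<mu>. y \<in> E"
    using AE_msupport[OF sets_mu] supp by (auto elim!: eventually_mono)
  interpret S: slab_measure \<mu> E K1 k
  proof
    show "(\<integral>\<^sup>+p. ennreal (1 / norm (fst p - snd p) ^ j) \<partial>(\<mu> \<Otimes>\<^sub>M \<mu>)) < \<infinity>" if "j \<le> k" for j
      using that s(2) by (intro energy_finite(1)[OF prob sets_mu K2]) auto
    show "AE p in \<mu> \<Otimes>\<^sub>M \<mu>. fst p \<noteq> snd p"
      using s(1) by (intro energy_finite(2)[OF prob sets_mu K2, of 0]) auto
  qed (use sets_mu assms(4) AE_E K1 in auto)
  obtain R where R: "R > 0" "\<And>x. x \<in> E \<Longrightarrow> norm x \<le> R"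
    using compact_imp_bounded[OF assms(4)] by (auto simp: bounded_pos)
  interpret Sq: slab_measure_gauge \<mu> E K1 k "\<lambda>s. s\<^sup>2" 1
    by unfold_locales auto
  \<comment> \<open>A difference of squares is the difference times the sum, and two distances
    between points of norm at most R sum to at most 4 R.\<close>
  interpret Id: slab_measure_gauge \<mu> E K1 k "\<lambda>s. s" "4 * R"
  proof
    fix x y y' assume E: "x \<in> E" "y \<in> E" "y' \<in> E"
    have "norm (x - y) + norm (x - y') \<le> 4 * R"
      using norm_triangle_ineq4[of x y] norm_triangle_ineq4[of x y'] R(2)[OF E(1)] R(2)[OF E(2)] R(2)[OF E(3)] by linarith
    then have "\<bar>norm (x - y) - norm (x - y')\<bar> * (norm (x - y) + norm (x - y')) \<le> \<bar>norm (x - y) - norm (x - y')\<bar> * (4 * R)"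
      by (intro mult_left_mono) auto
    moreover have "\<bar>(norm (x - y))\<^sup>2 - (norm (x - y'))\<^sup>2\<bar> = \<bar>norm (x - y) - norm (x - y')\<bar> * (norm (x - y) + norm (x - y'))"
      unfolding power2_eq_square square_diff_square_factored abs_mult by simp
    ultimately show "\<bar>(norm (x - y))\<^sup>2 - (norm (x - y'))\<^sup>2\<bar> \<le> 4 * R * \<bar>norm (x - y) - norm (x - y')\<bar>"
      by (simp add: mult.commute)
  qed (use R(1) in auto)
  have Phi: "Sq.gauge_map k = Phi k"
    by (intro ext) (simp add: Sq.gauge_map_def Phi_def)
  define P where "P x \<longleftrightarrow> (\<forall>N\<in>null_sets (lebesgue_tuples k). AE z in measure_power k \<mu>. Phi k x z \<notin> N) \<and>
      (\<forall>N\<in>null_sets (lebesgue_tuples k). AE z in measure_power k \<mu>. Id.gauge_map k x z \<notin> N)" for x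
  have "AE x in \<mu>. P x"
    using Sq.AE_gauge_map_null Id.AE_gauge_map_null unfolding Phi P_def by eventually_elim (rule conjI)
  then obtain Z where Z0: "\<And>x. x \<notin> Z \<Longrightarrow> P x" and Z_null: "Z \<in> null_sets \<mu>"
    by (rule AE_E3) (use S.space_mu in blast)
  note Z = Z_null Z0[unfolded P_def, THEN conjunct1, THEN bspec] Z0[unfolded P_def, THEN conjunct2, THEN bspec]
  \<comment> \<open>Removing a measurable null set from the closed support yields a Borel set
    without proving that the set of good x is measurable.\<close>
  define G where "G = msupport \<mu> - Z"
  have "Z \<in> sets borel" using Z(1) sets_mu by auto
  then have G_sets: "G \<in> sets borel"
    unfolding G_def by (rule sets.Diff[OF borel_closed[OF closed_msupport]])
  have "AE y in \<mu>. y \<in> G"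
    using AE_msupport[OF sets_mu] AE_not_in[OF Z(1)] by eventually_elim (simp add: G_def)
  then have G1: "emeasure \<mu> G = 1"
    by (intro emeasure_eq_1_AE) (simp_all add: sets_mu G_sets)
  have ac: "absolutely_continuous (lebesgue_tuples k) (distr (measure_power k \<mu>) (lebesgue_tuples k) (Phi k x))"
    if "x \<in> G" for x
    unfolding absolutely_continuous_def
  proof
    fix N assume N: "N \<in> null_sets (lebesgue_tuples k)"
    then have N_sets: "N \<in> sets (lebesgue_tuples k)" by auto
    have "emeasure (distr (measure_power k \<mu>) (lebesgue_tuples k) (Phi k x)) N
        = emeasure (measure_power k \<mu>) {z \<in> space (measure_power k \<mu>). Phi k x z \<in> N}"
      unfolding emeasure_distr[OF measurable_Phi[OF sets_mu] N_sets]
      by (rule arg_cong[where f = "emeasure (measure_power k \<mu>)"]) blast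
    also have "\<dots> = 0"
      using Z(2)[OF _ N, of x] that unfolding G_def by (intro emeasure_eq_0_AE) simp
    finally show "N \<in> null_sets (distr (measure_power k \<mu>) (lebesgue_tuples k) (Phi k x))"
      using N_sets by (intro null_setsI) simp_all
  qed
  have pos: "emeasure (lebesgue_tuples k) (nondeg_dist_set k x E) > 0" if "x \<in> G" for x
  proof (rule ccontr)
    assume "\<not> ?thesis"
    then have "nondeg_dist_set k x E \<in> null_sets (lebesgue_tuples k)"
      using sets_nondeg_dist_set[OF assms(4)] by (auto simp: not_less)
    \<comment> \<open>If the distance set were null, almost every tuple would have its distances
      outside it; but almost every tuple is nondegenerate and so lands inside.\<close>
    then have "AE z in measure_power k \<mu>. Id.gauge_map k x z \<notin> nondeg_dist_set k x E"
      using that unfolding G_def by (intro Z(3)) auto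
    moreover have "AE z in measure_power k \<mu>. z \<in> nondeg_tuples k x E"
      using kd by (intro S.AE_nondeg_tuples) simp
    ultimately have "AE z in measure_power k \<mu>. False"
      by eventually_elim (auto simp: nondeg_dist_set_eq Id.gauge_map_def)
    then show False
      using prob_space.AE_False[OF S.prob_space_power] by simp
  qed
  show ?thesis
  proof (intro exI conjI ballI)
    show "borel_prob_on E \<mu>" by (rule \<mu>)
    show "G \<subseteq> msupport \<mu>" unfolding G_def by blast
  qed (fact G_sets G1 ac pos)+
qed

end
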